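(* Let $1\le q<p<\infty$ and for each $n$ let $Z=Z_n$ be uniformly distributed in $\mathbb B_p^n$. Then the sequence $(n^{1/p-1/q}\|Z\|_q)_{n\in\mathbb N}$ satisfies an LDP on $\mathbb R$ with speed $n$ and good rate function \[ \mathcal I(z)=\begin{cases}\inf\limits_{z=z_1z_2,\ z_1,z_2\ge0}[\mathcal I_1(z_1)+\mathcal I_2(z_2)] & z\ge0,\\ +\infty & \text{otherwise},\end{cases} \] where $\mathcal I_1(z)=-\log z$ for $z\in(0,1]$ and $\mathcal I_1(z)=+\infty$ otherwise, and \[ \mathcal I_2(z)=\begin{cases}\inf\limits_{x\ge0,\,y>0,\ x^{1/q}y^{-1/p}=z}\Lambda^*(x,y) & z\ge0,\\ +\infty & z<0,\end{cases} \] with $\Lambda^*$ the Legendre–Fenchel transform of \[ \Lambda(t_1,t_2)=\log\int_{\mathbb R}e^{t_1|s|^q+t_2|s|^p}\frac{e^{-|s|^p/p}}{2p^{1/p}\Gamma(1+1/p)}\,ds,\qquad (t_1,t_2)\in\mathbb R^2. \]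
   Context: $\|x\|_p=(\sum_i|x_i|^p)^{1/p}$, $\mathbb B_p^n=\{x\in\mathbb R^n:\|x\|_p\le1\}$. A sequence of real random variables $(X_n)$ satisfies a large deviation principle (LDP) with speed $s(n)\to\infty$ and rate function $\mathcal I:\mathbb R\to[0,\infty]$ (lower semicontinuous) if for every Borel set $A$: $-\inf_{A^\circ}\mathcal I\le\liminf\frac1{s(n)}\log P(X_n\in A)\le\limsup\frac1{s(n)}\log P(X_n\in A)\le-\inf_{\overline A}\mathcal I$; it is good if its level sets $\{\mathcal I\le\alpha\}$ are compact. The Legendre–Fenchel transform is $\Lambda^*(x)=\sup_{u\in\mathbb R^2}[\langle u,x\rangle-\Lambda(u)]$. *)

theory Defs
  imports "HOL-Probability.Probability"
begin

definition lsc :: "(real \<Rightarrow> ereal) \<Rightarrow> bool" where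
  "lsc I \<longleftrightarrow> (\<forall>x. I x \<le> Liminf (at x) I)"

definition rate_function :: "(real \<Rightarrow> ereal) \<Rightarrow> bool" where
  "rate_function I \<longleftrightarrow> (\<forall>x. I x \<ge> 0) \<and> lsc I"

definition good_rate_function :: "(real \<Rightarrow> ereal) \<Rightarrow> bool" where
  "good_rate_function I \<longleftrightarrow> rate_function I \<and> (\<forall>\<alpha>::real. compact {x. I x \<le> ereal \<alpha>})"

definition elog :: "real \<Rightarrow> ereal" where
  "elog x = (if x \<le> 0 then -\<infinity> else ereal (ln x))"

text \<open>LDP for a sequence of laws: P n A is the probability that X_n lies in A.\<close>
definition LDP :: "(nat \<Rightarrow> real) \<Rightarrow> (nat \<Rightarrow> real set \<Rightarrow> real) \<Rightarrow> (real \<Rightarrow> ereal) \<Rightarrow> bool" where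
  "LDP s P I \<longleftrightarrow> rate_function I \<and>
     (\<forall>A \<in> sets borel.
        - (INF x\<in>interior A. I x) \<le> liminf (\<lambda>n. elog (P n A) / ereal (s n)) \<and>
        limsup (\<lambda>n. elog (P n A) / ereal (s n)) \<le> - (INF x\<in>closure A. I x))"

text \<open>Vectors in R^n are functions on {..<n} (elements of the space of the product measure).\<close>
definition lp_norm :: "real \<Rightarrow> nat \<Rightarrow> (nat \<Rightarrow> real) \<Rightarrow> real" where
  "lp_norm p n x = (\<Sum>i<n. \<bar>x i\<bar> powr p) powr (1 / p)"

definition lebesgue_n :: "nat \<Rightarrow> (nat \<Rightarrow> real) measure" where
  "lebesgue_n n = PiM {..<n} (\<lambda>_. lborel)"

definition lp_ball :: "real \<Rightarrow> nat \<Rightarrow> (nat \<Rightarrow> real) set" where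
  "lp_ball p n = {x \<in> space (lebesgue_n n). lp_norm p n x \<le> 1}"

definition unif_lp_ball :: "real \<Rightarrow> nat \<Rightarrow> (nat \<Rightarrow> real) measure" where
  "unif_lp_ball p n = uniform_measure (lebesgue_n n) (lp_ball p n)"

definition law_scaled_norm :: "real \<Rightarrow> real \<Rightarrow> nat \<Rightarrow> real set \<Rightarrow> real" where
  "law_scaled_norm p q n A =
     measure (unif_lp_ball p n)
       {x \<in> space (unif_lp_ball p n). real n powr (1/p - 1/q) * lp_norm q n x \<in> A}"

definition eln :: "ennreal \<Rightarrow> ereal" where
  "eln x = (if x = \<infinity> then \<infinity> else elog (enn2real x))"

definition Lambda :: "real \<Rightarrow> real \<Rightarrow> real \<times> real \<Rightarrow> ereal" where
  "Lambda p q t = eln (integral\<^sup>N lborel (\<lambda>s. ennreal (exp (fst t * abs s powr q + snd t * abs s powr p)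
        * (exp (- ((abs s powr p) / p)) / (2 * p powr (1/p) * Gamma (1 + 1/p))))))"

definition Lambda_star :: "real \<Rightarrow> real \<Rightarrow> real \<times> real \<Rightarrow> ereal" where
  "Lambda_star p q x = (SUP u\<in>(UNIV :: (real \<times> real) set).
       ereal (fst u * fst x + snd u * snd x) - Lambda p q u)"

definition I1 :: "real \<Rightarrow> ereal" where
  "I1 z = (if 0 < z \<and> z \<le> 1 then ereal (- ln z) else \<infinity>)"

definition I2 :: "real \<Rightarrow> real \<Rightarrow> real \<Rightarrow> ereal" where
  "I2 p q z = (if z \<ge> 0 then
      (INF xy \<in> {(x, y). x \<ge> 0 \<and> y > 0 \<and> x powr (1/q) * y powr (- 1/p) = z}. Lambda_star p q xy)
    else \<infinity>)"

definition Irate :: "real \<Rightarrow> real \<Rightarrow> real \<Rightarrow> ereal" where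
  "Irate p q z = (if z \<ge> 0 then
      (INF zz \<in> {(z1, z2). z1 \<ge> 0 \<and> z2 \<ge> 0 \<and> z = z1 * z2}. I1 (fst zz) + I2 p q (snd zz))
    else \<infinity>)"

end

(*
  Write ew t1 t2 s = exp (t1 |s|^q + t2 |s|^p) and Z t1 t2 for its integral. Dilating by n^(1/p) turns
  {X_n = z} into a set of vectors with mean |x_i|^p <= 1 and mean |x_i|^q = z^q. Chernoff's bound for
  Lebesgue measure with multipliers t1 and t2 <= 0 gives it volume at most exp (-n (t1 z^q + t2 - ln Z)).
  Weak duality shows that each such exponent, normalized by the volume of the ball, is below the rate
  function. For 0 < z < 1 there is a pair (t1, t2) satisfying the Kuhn-Tucker conditions: the density
  ew / Z has q-th moment z^q and p-th moment at most 1, and t2 = 0 if the latter is strict. For this pair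
  the exponent equals the rate function, and tilting by ew / Z with Chebyshev's inequality gives the
  matching lower bound. The sign of t1 changes only at the typical value of X_n, so a closed set splits
  into two one-sided events, each handled by a single pair; at z = 0 and z >= 1 the exponents are
  unbounded.
*)

theory Submission
  imports Defs "HOL-Real_Asymp.Real_Asymp"
begin

text \<open>The splitting z = z1 * z2 reflects polar coordinates: the p-norm of a uniform point has
  distribution function r^n on [0, 1], which is where \<open>I1\<close> comes from. No such random
  representation is used. The splitting enters through dilations, which act on the multipliers by
  (t1 a^q, t2 a^p): an optimal density whose p-th moment has p-th root a gives the witness z1 = a,
  so a < 1 corresponds to a slack constraint. The obstacle is the edge of the parameter domain.
  Normalizing the p-th moment by a dilation leaves the ratio of moments as the only freedom, and on
  the edge t2 = 0 all pairs are dilations of one another and share the ratio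
  \<open>ratio (- 1) 0\<close>. Smaller values of z^q are reached by letting the p-th moment drop
  below 1. At the other end, z close to 1 asks for densities concentrated near |s| = 1; they are
  found along the ray (l/q, -l/p), whose exponent is maximal there.\<close>

section \<open>Integrals over the line and extended logarithms\<close>

lemma integrable_cauchy_dominated:
  fixes h :: "real \<Rightarrow> real"
  assumes [measurable]: "h \<in> borel_measurable borel"
    and le: "\<And>s. \<bar>h s\<bar> \<le> C * inverse (1 + s\<^sup>2)"
  shows "integrable lborel h"
proof -
  have "integrable lborel (\<lambda>s::real. inverse (1 + s\<^sup>2))"
    using integrable_inverse_1_plus_square by (simp add: set_integrable_def einterval_def)
  then have "integrable lborel (\<lambda>s. C * inverse (1 + s\<^sup>2))" by simp
  then show ?thesis
    by (rule Bochner_Integration.integrable_bound) (auto intro!: AE_I2 order_trans[OF le])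
qed

text \<open>An integrand vanishing almost everywhere would force almost every point to be 0. The
  point 0 is exempt because \<open>\<bar>s\<bar> powr r\<close> is 0 there, even for
  \<open>r = 0\<close>.\<close>

lemma lborel_integral_pos:
  fixes h :: "real \<Rightarrow> real"
  assumes "integrable lborel h" and "\<And>s. s \<noteq> 0 \<Longrightarrow> h s > 0" and "h 0 \<ge> 0"
  shows "(LINT s|lborel. h s) > 0"
proof -
  have [measurable]: "h \<in> borel_measurable borel" using assms(1) by simp
  have nn: "h s \<ge> 0" for s using assms(2)[of s] assms(3) by (cases "s = 0") auto
  have "(LINT s|lborel. h s) \<noteq> 0"
  proof
    assume "(LINT s|lborel. h s) = 0"
    then have "AE s in lborel. h s = 0"
      using integral_nonneg_eq_0_iff_AE[OF assms(1)] nn by simp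
    then have "AE s in lborel. s = (0::real)"
      by eventually_elim (use assms(2) in fastforce)
    then have "AE s in lborel. s \<notin> {1<..<2::real}" by eventually_elim auto
    then have "emeasure lborel {1<..<2::real} = 0"
      by (subst (asm) AE_iff_measurable[of "{1<..<2::real}"]) auto
    then show False by simp
  qed
  moreover have "(LINT s|lborel. h s) \<ge> 0" using nn by (intro Bochner_Integration.integral_nonneg) auto
  ultimately show ?thesis by linarith
qed

text \<open>Covers \<open>x = \<infinity>\<close> as well, as needed where the integral in
  \<open>Lambda\<close> diverges.\<close>

lemma ln_le_eln:
  assumes "0 < r" "ennreal r \<le> x"
  shows "ereal (ln r) \<le> eln x"
proof (cases x)
  case (real y)
  then show ?thesis using assms by (auto simp: eln_def elog_def)
qed (auto simp: eln_def)

lemma elog_divide_le: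
  assumes "P \<le> exp (- (real n * \<alpha>))" "n > 0"
  shows "elog P / ereal (real n) \<le> ereal (- \<alpha>)"
proof (cases "P \<le> 0")
  case False
  then have "ln P \<le> - (real n * \<alpha>)" using assms by (metis ln_exp ln_mono not_le)
  then have "ln P / n \<le> - (real n * \<alpha>) / n" using assms(2) by (intro divide_right_mono) auto
  then show ?thesis using False assms(2) by (simp add: elog_def)
qed (use assms(2) in \<open>simp add: elog_def\<close>)

lemma elog_divide_ge:
  assumes "exp (- (real n * \<alpha>)) \<le> P" "n > 0"
  shows "ereal (- \<alpha>) \<le> elog P / ereal (real n)"
proof -
  have P: "P > 0" using assms(1) by (meson exp_gt_zero less_le_trans)
  then have "- (real n * \<alpha>) \<le> ln P" using assms by (simp add: ln_ge_iff)
  then have "- (real n * \<alpha>) / n \<le> ln P / n" using assms(2) by (intro divide_right_mono) auto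
  then show ?thesis using P assms(2) by (simp add: elog_def)
qed

section \<open>Exponential weights\<close>

locale lp_exponents =
  fixes p q :: real
  assumes q_ge_1: "1 \<le> q" and q_less_p: "q < p"
begin

lemma pq_pos: "0 < q" "0 < p" "1 < p"
  using q_ge_1 q_less_p by auto

definition ew :: "real \<Rightarrow> real \<Rightarrow> real \<Rightarrow> real" where
  "ew t1 t2 s = exp (t1 * \<bar>s\<bar> powr q + t2 * \<bar>s\<bar> powr p)"

definition Z :: "real \<Rightarrow> real \<Rightarrow> real" where
  "Z t1 t2 = (LINT s|lborel. ew t1 t2 s)"

definition mom :: "real \<Rightarrow> real \<Rightarrow> real \<Rightarrow> real" where
  "mom r t1 t2 = (LINT s|lborel. \<bar>s\<bar> powr r * ew t1 t2 s)"

text \<open>Exactly the parameters for which \<open>ew\<close> is integrable, because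
  \<open>q < p\<close> lets the second term dominate. The edge \<open>t2 = 0\<close> is kept since
  it carries the pairs with a slack moment constraint.\<close>

definition admissible :: "real \<Rightarrow> real \<Rightarrow> bool" where
  "admissible t1 t2 \<longleftrightarrow> t2 < 0 \<or> t2 = 0 \<and> t1 < 0"

lemma admissible_le_0: "admissible t1 t2 \<Longrightarrow> t2 \<le> 0"
  by (auto simp: admissible_def)

lemma ew_pos [simp]: "ew t1 t2 s > 0" and ew_nonneg [simp]: "ew t1 t2 s \<ge> 0"
  by (auto simp: ew_def)

lemma ew_measurable [measurable]: "ew t1 t2 \<in> borel_measurable borel"
  unfolding ew_def by measurable

text \<open>Half of \<open>t2 * s powr p\<close> absorbs \<open>t1 * s powr q\<close>, since
  \<open>q < p\<close>; the other half, or the q-term alone on the edge, beats every power. The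
  factor \<open>1 + s\<^sup>2\<close> is there to leave a Cauchy tail as majorant.\<close>

lemma weight_tendsto_0:
  assumes "admissible t1 t2" "0 \<le> r"
  shows "((\<lambda>s. (1 + s\<^sup>2) * (1 + s powr r) * exp (t1 * s powr q + t2 * s powr p)) \<longlongrightarrow> 0) at_top"
proof (cases "t2 = 0")
  case True
  then have "t1 < 0" "0 < q" using assms(1) pq_pos by (auto simp: admissible_def)
  have "((\<lambda>s. (1 + s\<^sup>2) * (1 + s powr r) * exp (t1 * s powr q)) \<longlongrightarrow> 0) at_top"
    using \<open>t1 < 0\<close> \<open>0 < q\<close> assms(2) by real_asymp
  then show ?thesis using True by simp
next
  case False
  then have "t2 < 0" "0 < q" "0 < p" "q < p" using assms pq_pos q_less_p by (auto simp: admissible_def)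
  have "((\<lambda>s. (1 + s\<^sup>2) * (1 + s powr r) * exp (t2 / 2 * s powr p)) \<longlongrightarrow> 0) at_top"
    using \<open>t2 < 0\<close> \<open>0 < p\<close> assms(2) by real_asymp
  moreover have "\<forall>\<^sub>F s in at_top. t1 * s powr q \<le> - t2 / 2 * s powr p"
  proof -
    have "((\<lambda>s::real. s powr (q - p)) \<longlongrightarrow> 0) at_top"
      using q_less_p by (intro tendsto_neg_powr filterlim_ident) auto
    then have "((\<lambda>s::real. t1 * s powr (q - p)) \<longlongrightarrow> t1 * 0) at_top" by (intro tendsto_intros)
    moreover have "t1 * 0 < - t2 / 2" using \<open>t2 < 0\<close> by simp
    ultimately have "\<forall>\<^sub>F s in at_top. t1 * s powr (q - p) < - t2 / 2" by (rule order_tendstoD)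
    then show ?thesis using eventually_gt_at_top[of 0]
    proof eventually_elim
      case (elim s)
      then have "t1 * s powr (q - p) * s powr p \<le> - t2 / 2 * s powr p"
        by (intro mult_right_mono) auto
      then show ?case by (simp add: mult.assoc flip: powr_add)
    qed
  qed
  ultimately show ?thesis
    apply (elim tendsto_sandwich[rotated 3, where f = "\<lambda>_. 0"])
    subgoal by (auto intro!: always_eventually)
    subgoal
    proof (elim eventually_mono)
      fix s :: real assume *: "t1 * s powr q \<le> - t2 / 2 * s powr p"
      then have "t1 * s powr q + t2 * s powr p \<le> t2 / 2 * s powr p" by (simp add: field_simps)
      then show "(1 + s\<^sup>2) * (1 + s powr r) * exp (t1 * s powr q + t2 * s powr p)
          \<le> (1 + s\<^sup>2) * (1 + s powr r) * exp (t2 / 2 * s powr p)"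
        by (intro mult_left_mono) auto
    qed
    subgoal by simp
    done
qed

lemma integrable_weight:
  assumes "admissible t1 t2" "0 \<le> r"
  shows "integrable lborel (\<lambda>s. (1 + \<bar>s\<bar> powr r) * ew t1 t2 s)"
proof -
  from weight_tendsto_0[OF assms]
  have "\<forall>\<^sub>F s in at_top. (1 + s\<^sup>2) * (1 + s powr r) * exp (t1 * s powr q + t2 * s powr p) < 1"
    by (rule order_tendstoD) simp
  then obtain R0 where R0: "\<And>s. s \<ge> R0 \<Longrightarrow> (1 + s\<^sup>2) * (1 + s powr r) * exp (t1 * s powr q + t2 * s powr p) < 1"
    by (auto simp: eventually_at_top_linorder)
  define R where "R = max R0 0"
  define C where "C = max 1 ((1 + R\<^sup>2) * (1 + R powr r) * exp (\<bar>t1\<bar> * R powr q))"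
  have bd: "(1 + s\<^sup>2) * (1 + \<bar>s\<bar> powr r) * ew t1 t2 s \<le> C" for s
  proof (cases "\<bar>s\<bar> \<ge> R")
    case True
    then have "(1 + s\<^sup>2) * (1 + \<bar>s\<bar> powr r) * ew t1 t2 s < 1"
      using R0[of "\<bar>s\<bar>"] by (simp add: R_def ew_def)
    then show ?thesis by (simp add: C_def le_max_iff_disj)
  next
    case False
    have "s\<^sup>2 \<le> R\<^sup>2" using False by (intro abs_le_square_iff[THEN iffD1]) auto
    moreover have "\<bar>s\<bar> powr r \<le> R powr r" using False assms by (intro powr_mono2) auto
    moreover have "ew t1 t2 s \<le> exp (\<bar>t1\<bar> * R powr q)"
    proof -
      have "t1 * \<bar>s\<bar> powr q \<le> \<bar>t1\<bar> * R powr q"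
        using False pq_pos by (intro mult_mono powr_mono2) auto
      moreover have "t2 * \<bar>s\<bar> powr p \<le> 0"
        using admissible_le_0[OF assms(1)] by (simp add: mult_nonpos_nonneg)
      ultimately show ?thesis by (simp add: ew_def)
    qed
    ultimately have "(1 + s\<^sup>2) * (1 + \<bar>s\<bar> powr r) * ew t1 t2 s
      \<le> (1 + R\<^sup>2) * (1 + R powr r) * exp (\<bar>t1\<bar> * R powr q)"
      by (intro mult_mono) auto
    then show ?thesis by (simp add: C_def)
  qed
  show ?thesis
  proof (rule integrable_cauchy_dominated)
    fix s :: real
    have pos: "1 + s\<^sup>2 > 0" by (simp add: add_pos_nonneg)
    have "\<bar>(1 + \<bar>s\<bar> powr r) * ew t1 t2 s\<bar> = (1 + \<bar>s\<bar> powr r) * ew t1 t2 s" by (simp add: abs_mult)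
    also have "\<dots> \<le> C / (1 + s\<^sup>2)"
      using bd[of s] pos by (simp add: pos_le_divide_eq mult_ac)
    finally show "\<bar>(1 + \<bar>s\<bar> powr r) * ew t1 t2 s\<bar> \<le> C * inverse (1 + s\<^sup>2)"
      by (simp add: divide_inverse)
  qed simp
qed

lemma integrable_dominated_weight:
  assumes "admissible t1 t2" "0 \<le> r" and [measurable]: "h \<in> borel_measurable borel"
    and "\<And>s. \<bar>h s\<bar> \<le> C * (1 + \<bar>s\<bar> powr r)"
  shows "integrable lborel (\<lambda>s. h s * ew t1 t2 s)"
proof (rule Bochner_Integration.integrable_bound)
  show "integrable lborel (\<lambda>s. C * ((1 + \<bar>s\<bar> powr r) * ew t1 t2 s))"
    using integrable_weight[OF assms(1,2)] by simp
  have "\<bar>h s\<bar> * ew t1 t2 s \<le> \<bar>C * ((1 + \<bar>s\<bar> powr r) * ew t1 t2 s)\<bar>" for s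
    using mult_right_mono[OF assms(4)[of s], of "ew t1 t2 s"]
    by (intro order_trans[OF _ abs_ge_self]) (simp add: mult.assoc)
  then show "AE s in lborel. norm (h s * ew t1 t2 s) \<le> norm (C * ((1 + \<bar>s\<bar> powr r) * ew t1 t2 s))"
    by (simp add: abs_mult)
qed simp

lemma integrable_powr_ew:
  assumes "admissible t1 t2" "0 \<le> r"
  shows "integrable lborel (\<lambda>s. \<bar>s\<bar> powr r * ew t1 t2 s)"
  by (rule integrable_dominated_weight[OF assms, where C = 1]) auto

lemma integrable_ew:
  assumes "admissible t1 t2"
  shows "integrable lborel (ew t1 t2)"
  using integrable_dominated_weight[OF assms, where r = 0 and C = 1 and h = "\<lambda>_. 1"] by simp

lemma Z_pos: "admissible t1 t2 \<Longrightarrow> Z t1 t2 > 0"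
  unfolding Z_def by (intro lborel_integral_pos integrable_ew) auto

lemma mom_pos: "admissible t1 t2 \<Longrightarrow> 0 \<le> r \<Longrightarrow> mom r t1 t2 > 0"
  unfolding mom_def by (intro lborel_integral_pos integrable_powr_ew) auto

section \<open>Dilations, moments and Jensen's inequality\<close>

text \<open>An extended-valued twin of \<open>Z\<close>: the Bochner integral is 0 where the weight
  is not integrable, whereas \<open>Lambda\<close> must be \<open>\<infinity>\<close> there.\<close>

definition nZ :: "real \<Rightarrow> real \<Rightarrow> ennreal" where
  "nZ t1 t2 = (\<integral>\<^sup>+s. ennreal (ew t1 t2 s) \<partial>lborel)"

lemma nZ_eq_Z: "admissible t1 t2 \<Longrightarrow> nZ t1 t2 = ennreal (Z t1 t2)"
  unfolding nZ_def Z_def by (intro nn_integral_eq_integral integrable_ew) auto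

text \<open>Dilations of the line act on the parameters. They move the p-th moment freely, which is
  how the normalizations below are made.\<close>

lemma ew_scale: "0 < a \<Longrightarrow> ew (t1 * a powr q) (t2 * a powr p) s = ew t1 t2 (a * s)"
  by (simp add: ew_def abs_mult powr_mult mult_ac)

lemma admissible_scale: "0 < a \<Longrightarrow> 0 < b \<Longrightarrow> admissible (t1 * a) (t2 * b) \<longleftrightarrow> admissible t1 t2"
  by (auto simp: admissible_def mult_less_0_iff)

lemma nZ_scale:
  assumes "0 < a"
  shows "ennreal a * nZ (t1 * a powr q) (t2 * a powr p) = nZ t1 t2"
  unfolding nZ_def ew_scale[OF assms]
  using nn_integral_real_affine[where f = "\<lambda>s. ennreal (ew t1 t2 s)" and c = a and t = 0] assms by simp

lemma Z_scale:
  assumes "0 < a"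
  shows "Z (t1 * a powr q) (t2 * a powr p) = Z t1 t2 / a"
  unfolding Z_def ew_scale[OF assms]
  using lborel_integral_real_affine[where f = "ew t1 t2" and c = a and t = 0] assms by simp

lemma mom_scale:
  assumes "0 < a"
  shows "mom r (t1 * a powr q) (t2 * a powr p) = mom r t1 t2 / a powr r / a"
proof -
  have "(LINT s|lborel. \<bar>s\<bar> powr r * ew t1 t2 (a * s))
    = (LINT s|lborel. \<bar>a * s\<bar> powr r * ew t1 t2 (a * s)) / a powr r"
    using assms by (subst integral_divide_zero[symmetric]) (simp add: abs_mult powr_mult)
  then show ?thesis unfolding mom_def ew_scale[OF assms]
  using lborel_integral_real_affine[where f = "\<lambda>s. \<bar>s\<bar> powr r * ew t1 t2 s" and c = a and t = 0] assms by simp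
qed

definition mean :: "real \<Rightarrow> real \<Rightarrow> real \<Rightarrow> real" where
  "mean r t1 t2 = mom r t1 t2 / Z t1 t2"

lemma mean_pos: "admissible t1 t2 \<Longrightarrow> 0 \<le> r \<Longrightarrow> mean r t1 t2 > 0"
  by (simp add: mean_def mom_pos Z_pos)

lemma mean_scale: "0 < a \<Longrightarrow> mean r (t1 * a powr q) (t2 * a powr p) = mean r t1 t2 / a powr r"
  by (simp add: mean_def Z_scale mom_scale)

text \<open>Jensen's inequality for the density \<open>ew t1 t2 / Z t1 t2\<close>.\<close>

lemma nZ_ge:
  assumes "admissible t1 t2"
  shows "nZ v1 v2 \<ge> ennreal (Z t1 t2 * exp ((v1 - t1) * mean q t1 t2 + (v2 - t2) * mean p t1 t2))"
proof (cases "nZ v1 v2 = \<infinity>")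
  case False
  \<comment> \<open>\<open>m\<close> is the mean of \<open>L\<close>, so the tangent line of exp at
    \<open>m\<close>, evaluated at \<open>L s\<close>, integrates to \<open>exp m\<close> times the
    mass.\<close>
  define m where "m = (v1 - t1) * mean q t1 t2 + (v2 - t2) * mean p t1 t2"
  define L where "L s = (v1 - t1) * \<bar>s\<bar> powr q + (v2 - t2) * \<bar>s\<bar> powr p" for s
  have int: "integrable lborel (ew v1 v2)"
    using False by (intro integrableI_nonneg) (auto simp: nZ_def top.not_eq_extremum)
  note i = integrable_ew[OF assms] integrable_powr_ew[OF assms, of q] integrable_powr_ew[OF assms, of p]
  have eq: "exp m * (1 + L s - m) * ew t1 t2 s = exp m * (1 - m) * ew t1 t2 s
      + exp m * (v1 - t1) * (\<bar>s\<bar> powr q * ew t1 t2 s) + exp m * (v2 - t2) * (\<bar>s\<bar> powr p * ew t1 t2 s)" for s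
    by (simp add: L_def algebra_simps)
  have i2: "integrable lborel (\<lambda>s. exp m * (1 + L s - m) * ew t1 t2 s)"
    unfolding eq using i pq_pos by auto
  have "(LINT s|lborel. exp m * (1 + L s - m) * ew t1 t2 s)
     = exp m * (1 - m) * Z t1 t2 + exp m * (v1 - t1) * mom q t1 t2 + exp m * (v2 - t2) * mom p t1 t2"
    unfolding eq using i pq_pos by (simp add: Z_def mom_def)
  also have "\<dots> = exp m * Z t1 t2"
    using Z_pos[OF assms] by (simp add: m_def mean_def field_simps)
  finally have "exp m * Z t1 t2 = (LINT s|lborel. exp m * (1 + L s - m) * ew t1 t2 s)" ..
  also have "\<dots> \<le> (LINT s|lborel. ew v1 v2 s)"
  proof (rule integral_mono[OF i2 int])
    fix s
    have "ew v1 v2 s = exp m * exp (L s - m) * ew t1 t2 s"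
      by (simp add: ew_def L_def algebra_simps flip: exp_add)
    moreover have "1 + L s - m \<le> exp (L s - m)" using exp_ge_add_one_self[of "L s - m"] by linarith
    ultimately show "exp m * (1 + L s - m) * ew t1 t2 s \<le> ew v1 v2 s"
      by (simp add: mult_left_mono mult_right_mono del: mult_le_cancel_right mult_le_cancel_left)
  qed
  also have "ennreal \<dots> = nZ v1 v2"
    unfolding nZ_def by (intro nn_integral_eq_integral[symmetric] int) auto
  finally show ?thesis by (simp add: m_def mult.commute ennreal_leI)
qed simp

text \<open>The layer-cake formula \<open>exp (-a) = \<integral>\<^bsub>r > a\<^esub> exp (-r)\<close> and Tonelli turn the left side
  into the Gamma integral without a change of variables.\<close>

lemma Z_gamma: "Z 0 (- (1 / p)) = 2 * p powr (1/p) * Gamma (1 + 1/p)"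
proof -
  note pp = pq_pos
  have Gp: "Gamma (1 + 1/p) > 0" using pp by (intro Gamma_real_pos) (auto simp: field_simps add_pos_pos)
  have layer: "ennreal (exp (- a)) = (\<integral>\<^sup>+r. ennreal (exp (-r)) * indicator {a..} r \<partial>lborel)" for a :: real
  proof -
    have "(\<integral>\<^sup>+r. ennreal (exp (-r)) * indicator {a..} r \<partial>lborel) = ennreal (0 - (- exp (- a)))"
    proof (rule nn_integral_FTC_atLeast)
      show "((\<lambda>r::real. - exp (- r)) \<longlongrightarrow> 0) at_top" by real_asymp
    qed (auto intro!: derivative_eq_intros)
    then show ?thesis by simp
  qed
  have "nZ 0 (- (1 / p)) = (\<integral>\<^sup>+s. \<integral>\<^sup>+r. ennreal (exp (-r)) * indicator {\<bar>s\<bar> powr p / p..} r \<partial>lborel \<partial>lborel)"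
    unfolding nZ_def ew_def layer[symmetric] by simp
  also have "\<dots> = (\<integral>\<^sup>+r. \<integral>\<^sup>+s. ennreal (exp (-r)) * indicator {\<bar>s\<bar> powr p / p..} r \<partial>lborel \<partial>lborel)"
  proof (rule lborel_pair.Fubini')
    have "(\<lambda>(r, s). ennreal (exp (-r)) * indicator {\<bar>s\<bar> powr p / p..} r)
      = (\<lambda>z. ennreal (exp (- fst z)) * (if \<bar>snd z\<bar> powr p / p \<le> fst z then 1 else 0))"
      by (auto simp: indicator_def)
    also have "\<dots> \<in> borel_measurable (lborel \<Otimes>\<^sub>M lborel)" by measurable
    finally show "(\<lambda>(r, s). ennreal (exp (-r)) * indicator {\<bar>s\<bar> powr p / p..} r)
      \<in> borel_measurable (lborel \<Otimes>\<^sub>M lborel)" .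
  qed
  also have "\<dots> = (\<integral>\<^sup>+r. ennreal (2 * p powr (1/p)) * ennreal (indicator {0..} r * r powr (1 + 1/p - 1) / exp r) \<partial>lborel)"
  proof (rule nn_integral_cong)
    fix r :: real
    show "(\<integral>\<^sup>+s. ennreal (exp (-r)) * indicator {\<bar>s\<bar> powr p / p..} r \<partial>lborel)
      = ennreal (2 * p powr (1/p)) * ennreal (indicator {0..} r * r powr (1 + 1/p - 1) / exp r)"
    proof (cases "r \<ge> 0")
      case True
      have iff: "\<bar>s\<bar> powr p / p \<le> r \<longleftrightarrow> s \<in> {- ((p * r) powr (1/p)) .. (p * r) powr (1/p)}" for s
      proof -
        have "\<bar>s\<bar> powr p / p \<le> r \<longleftrightarrow> \<bar>s\<bar> powr p \<le> p * r" using pp by (simp add: field_simps)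
        also have "\<dots> \<longleftrightarrow> \<bar>s\<bar> \<le> (p * r) powr (1/p)"
        proof
          assume "\<bar>s\<bar> powr p \<le> p * r"
          then have "(\<bar>s\<bar> powr p) powr (1/p) \<le> (p * r) powr (1/p)" using pp by (intro powr_mono2) auto
          then show "\<bar>s\<bar> \<le> (p * r) powr (1/p)" using pp by (simp add: powr_powr)
        next
          assume "\<bar>s\<bar> \<le> (p * r) powr (1/p)"
          then have "\<bar>s\<bar> powr p \<le> ((p * r) powr (1/p)) powr p" using pp by (intro powr_mono2) auto
          then show "\<bar>s\<bar> powr p \<le> p * r" using pp True by (simp add: powr_powr)
        qed
        finally show ?thesis by auto
      qed
      have "(\<integral>\<^sup>+s. ennreal (exp (-r)) * indicator {\<bar>s\<bar> powr p / p..} r \<partial>lborel)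
        = (\<integral>\<^sup>+s. ennreal (exp (-r)) * indicator {- ((p * r) powr (1/p)) .. (p * r) powr (1/p)} s \<partial>lborel)"
        using iff by (intro nn_integral_cong) (auto simp: indicator_def)
      also have "\<dots> = ennreal (exp (-r)) * ennreal (2 * (p * r) powr (1/p))"
        by (subst nn_integral_cmult_indicator) auto
      also have "\<dots> = ennreal (2 * p powr (1/p)) * ennreal (r powr (1/p) * exp (- r))"
        using pp True by (simp add: powr_mult mult_ac flip: ennreal_mult)
      finally show ?thesis using True by (simp add: exp_minus divide_inverse)
    next
      case False
      have "\<bar>s\<bar> powr p / p \<ge> 0" for s using pp by simp
      then have "\<not> \<bar>s\<bar> powr p / p \<le> r" for s using False by (meson order_trans)
      then show ?thesis using False by (simp add: indicator_def)
    qed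
  qed
  also have "\<dots> = ennreal (2 * p powr (1/p)) * ennreal (Gamma (1 + 1/p))"
    using pp by (subst nn_integral_cmult) (auto simp: Gamma_conv_nn_integral_real add_pos_pos)
  also have "\<dots> = ennreal (2 * p powr (1/p) * Gamma (1 + 1/p))"
    using Gp by (simp add: ennreal_mult)
  finally have "ennreal (Z 0 (- (1 / p))) = ennreal (2 * p powr (1/p) * Gamma (1 + 1/p))"
    using nZ_eq_Z[of 0 "- (1/p)"] pp by (simp add: admissible_def)
  then show ?thesis
    using Gp Z_pos[of 0 "- (1/p)"] pp by (subst (asm) ennreal_inj) (auto simp: admissible_def)
qed

section \<open>Duality for the rate function\<close>

text \<open>This pair gives the p-generalized Gaussian, the reference density inside
  \<open>Lambda\<close>; the rate function vanishes at the corresponding typical value.\<close>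

lemma admissible_std: "admissible 0 (- (1 / p))"
  using pq_pos by (simp add: admissible_def)

definition norm_const :: real where "norm_const = Z 0 (- (1 / p))"

lemma norm_const_pos: "norm_const > 0"
  unfolding norm_const_def by (rule Z_pos[OF admissible_std])

text \<open>The reference density shifts the second parameter by \<open>1 / p\<close>, and by
  \<open>Z_gamma\<close> its normalizing constant is itself a value of \<open>Z\<close>; after this
  the Gamma function no longer appears.\<close>

lemma Lambda_eq: "Lambda p q (u1, u2) = eln (nZ u1 (u2 - 1 / p) * ennreal (1 / norm_const))"
proof -
  have "(\<integral>\<^sup>+s. ennreal (exp (u1 * \<bar>s\<bar> powr q + u2 * \<bar>s\<bar> powr p) *
      (exp (- (\<bar>s\<bar> powr p / p)) / norm_const)) \<partial>lborel)
    = (\<integral>\<^sup>+s. ennreal (ew u1 (u2 - 1 / p) s) * ennreal (1 / norm_const) \<partial>lborel)"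
    using norm_const_pos by (intro nn_integral_cong)
      (simp add: ew_def algebra_simps flip: ennreal_mult exp_add)
  then show ?thesis
    by (simp add: Lambda_def nZ_def nn_integral_multc norm_const_def Z_gamma)
qed

text \<open>The supremum in \<open>Lambda_star\<close> ranges over the whole plane, so
  \<open>Lambda\<close> must be bounded below also where the integral diverges.\<close>

lemma Lambda_ge:
  assumes "0 < r" "ennreal r \<le> nZ u1 (u2 - 1 / p)"
  shows "ereal (ln r - ln norm_const) \<le> Lambda p q (u1, u2)"
proof -
  have "ennreal (r / norm_const) \<le> nZ u1 (u2 - 1 / p) * ennreal (1 / norm_const)"
    using mult_right_mono[OF assms(2), of "ennreal (1 / norm_const)"] assms(1) norm_const_pos
    by (simp add: ennreal_mult[symmetric])
  then have "ereal (ln (r / norm_const)) \<le> Lambda p q (u1, u2)"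
    unfolding Lambda_eq using assms norm_const_pos by (intro ln_le_eln) auto
  then show ?thesis using assms norm_const_pos by (simp add: ln_div)
qed

lemma Lambda_dom:
  assumes "admissible u1 (u2 - 1 / p)"
  shows "Lambda p q (u1, u2) = ereal (ln (Z u1 (u2 - 1 / p)) - ln norm_const)"
  unfolding Lambda_eq nZ_eq_Z[OF assms]
  using Z_pos[OF assms] norm_const_pos
  by (simp add: eln_def elog_def ln_div divide_le_0_iff not_le flip: ennreal_mult)

text \<open>The exponential growth rate, per coordinate, of the volume of the ball dilated by
  \<open>n powr (1 / p)\<close>. The value makes \<open>val\<close> vanish at
  \<open>(0, - (1 / p))\<close>; \<open>vol_UNIV_lower\<close> and \<open>vol_UNIV_le\<close>
  confirm it.\<close>

definition ball_exponent :: real where "ball_exponent = 1 / p + ln norm_const"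

definition val :: "real \<Rightarrow> real \<Rightarrow> real \<Rightarrow> real" where
  "val t1 t2 x = ball_exponent + t1 * x + t2 - ln (Z t1 t2)"

text \<open>Weak duality. The parameter of \<open>Lambda_star\<close> is the dilation of \<open>(t1, t2)\<close> by
  \<open>a = z1 * y powr (- 1/p)\<close>; since \<open>(a\<^sup>q x, a\<^sup>p y) = (z\<^sup>q, z1\<^sup>p)\<close>, the exponents match.\<close>

lemma val_le_Irate:
  assumes z: "0 \<le> z" and t: "admissible t1 t2"
  shows "ereal (val t1 t2 (z powr q)) \<le> Irate p q z"
proof -
  note pp = pq_pos
  have main: "ereal (val t1 t2 (z powr q) + ln z1) \<le> Lambda_star p q (x, y)"
    if h: "0 < z1" "z1 \<le> 1" "0 \<le> x" "0 < y" "z = z1 * (x powr (1/q) * y powr (- 1/p))" for z1 x y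
  proof -
    define a where "a = z1 * y powr (- 1/p)"
    have a: "a > 0" using h by (simp add: a_def)
    have zq: "z powr q = a powr q * x"
      using h pp by (simp add: a_def powr_mult powr_powr mult_ac)
    have ap: "a powr p * y = z1 powr p"
    proof -
      have "a powr p = z1 powr p * y powr (-1)"
        using h pp by (simp add: a_def powr_mult powr_powr)
      then show ?thesis using h by (simp add: powr_minus)
    qed
    have lna: "ln a = ln z1 - ln y / p"
      using h by (simp add: a_def ln_mult ln_powr)
    have d: "admissible (t1 * a powr q) (t2 * a powr p)" using t admissible_scale a by simp
    have "z1 powr p \<le> 1 powr p" using h pp by (intro powr_mono2) auto
    then have "t2 * 1 \<le> t2 * z1 powr p" using admissible_le_0[OF t] by (intro mult_left_mono_neg) auto
    \<comment> \<open>\<open>ln y \<le> y - 1\<close> pays for \<open>y \<noteq> 1\<close>; equality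
      at \<open>y = 1\<close> explains the witness chosen in \<open>Irate_le_val\<close>.\<close>
    moreover have "1 / p \<le> y / p - ln y / p"
      using ln_le_minus_one[of y] h pp by (simp add: field_simps)
    ultimately have "val t1 t2 (z powr q) + ln z1 \<le>
        t1 * a powr q * x + (t2 * a powr p + 1 / p) * y - (ln (Z t1 t2 / a) - ln norm_const)"
      using a Z_pos[OF t] ap
      by (simp add: val_def ball_exponent_def zq lna ln_div algebra_simps)
    also have "ereal \<dots> = ereal (fst (t1 * a powr q, t2 * a powr p + 1 / p) * fst (x, y) +
       snd (t1 * a powr q, t2 * a powr p + 1 / p) * snd (x, y)) - Lambda p q (t1 * a powr q, t2 * a powr p + 1 / p)"
      using d a by (simp add: Lambda_dom Z_scale)
    also have "\<dots> \<le> Lambda_star p q (x, y)"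
      unfolding Lambda_star_def by (rule SUP_upper) simp
    finally show ?thesis by simp
  qed
  show ?thesis
    unfolding Irate_def using z
  proof (simp, intro INF_greatest, clarsimp)
    fix z1 z2 assume zz: "0 \<le> z1" "0 \<le> z2" "z = z1 * z2"
    show "ereal (val t1 t2 ((z1 * z2) powr q)) \<le> I1 z1 + I2 p q z2"
    proof (cases "0 < z1 \<and> z1 \<le> 1")
      case True
      have "ereal (val t1 t2 ((z1 * z2) powr q) + ln z1) \<le> I2 p q z2"
        unfolding I2_def using zz(2)
      proof (simp, intro INF_greatest, clarsimp)
        fix x y :: real assume xy: "0 \<le> x" "0 < y" "z2 = x powr (1 / q) * y powr - (1 / p)"
        show "ereal (val t1 t2 ((z1 * (x powr (1 / q) * y powr - (1 / p))) powr q) + ln z1)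
           \<le> Lambda_star p q (x, y)"
          using main[of z1 x y] zz(3) xy True by simp
      qed
      then have "ereal (- ln z1) + ereal (val t1 t2 ((z1 * z2) powr q) + ln z1) \<le> ereal (- ln z1) + I2 p q z2"
        by (rule add_left_mono)
      then show ?thesis using True by (simp add: I1_def)
    next
      case False
      then have "I1 z1 = \<infinity>" by (auto simp: I1_def)
      then show ?thesis by simp
    qed
  qed
qed

text \<open>The bound of \<open>val_le_Irate\<close> is attained at \<open>z1 = a\<close> and
  \<open>(x, y) = ((z / a) powr q, 1)\<close>, with \<open>a\<close> the p-th root of the p-th
  moment: \<open>x\<close> and \<open>y\<close> are the moments of the optimal density dilated to
  p-th moment 1. Jensen bounds \<open>Lambda_star\<close> there, and \<open>mp\<close> gives
  \<open>a \<le> 1\<close>, so that \<open>I1 a\<close> is finite.\<close>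

lemma Irate_le_val:
  assumes z: "0 \<le> z" and t: "admissible t1 t2" and mq: "mean q t1 t2 = z powr q"
    and mp: "mean p t1 t2 \<le> 1" and slack: "t2 * (1 - mean p t1 t2) = 0"
  shows "Irate p q z \<le> ereal (val t1 t2 (z powr q))"
proof -
  note pp = pq_pos
  define a where "a = mean p t1 t2 powr (1/p)"
  have m0: "mean p t1 t2 > 0" using mean_pos t pp by simp
  have a: "0 < a" using m0 by (simp add: a_def)
  have ap: "a powr p = mean p t1 t2" using m0 pp by (simp add: a_def powr_powr)
  have "a \<le> 1 powr (1/p)" unfolding a_def using m0 mp pp by (intro powr_mono2) auto
  then have a1: "a \<le> 1" by simp
  have "Lambda_star p q ((z / a) powr q, 1) \<le> ereal (val t1 t2 (z powr q) + ln a)"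
    unfolding Lambda_star_def
  proof (rule SUP_least)
    fix u :: "real \<times> real"
    obtain u1 u2 where u: "u = (u1, u2)" by (cases u)
    \<comment> \<open>\<open>u\<close>, shifted by the reference density and carried back by the
      dilation to the scale of \<open>(t1, t2)\<close>, where Jensen applies.\<close>
    define v1 v2 where "v1 = u1 / a powr q" and "v2 = (u2 - 1 / p) / a powr p"
    define m where "m = (v1 - t1) * mean q t1 t2 + (v2 - t2) * mean p t1 t2"
    have "ennreal (Z t1 t2 * exp m / a) \<le> nZ u1 (u2 - 1 / p)"
    proof -
      have "ennreal (a * (Z t1 t2 * exp m / a)) \<le> nZ v1 v2"
        using nZ_ge[OF t, of v1 v2] a by (simp add: m_def)
      also have "\<dots> = ennreal a * nZ u1 (u2 - 1 / p)"
        using nZ_scale[OF a, of v1 v2] a by (simp add: v1_def v2_def)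
      finally have le: "ennreal a * ennreal (Z t1 t2 * exp m / a) \<le> ennreal a * nZ u1 (u2 - 1 / p)"
        using a by (simp only: ennreal_mult')
      then show ?thesis
        using a by (subst (asm) ennreal_mult_le_mult_iff) (auto simp: ennreal_eq_0_iff)
    qed
    then have "ereal (ln (Z t1 t2 * exp m / a) - ln norm_const) \<le> Lambda p q u"
      unfolding u using a Z_pos[OF t] by (intro Lambda_ge) auto
    then have "ereal (ln (Z t1 t2) + m - ln a - ln norm_const) \<le> Lambda p q u"
      using a Z_pos[OF t] by (simp add: ln_div ln_mult)
    then have "ereal (fst u * (z / a) powr q + snd u * 1) - Lambda p q u
      \<le> ereal (fst u * (z / a) powr q + snd u * 1) - ereal (ln (Z t1 t2) + m - ln a - ln norm_const)"
      by (intro ereal_minus_mono) auto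
    also have "\<dots> = ereal (val t1 t2 (z powr q) + ln a)"
    proof -
      have 1: "v1 * mean q t1 t2 = u1 * (z / a) powr q"
        using z a by (simp add: v1_def mq powr_divide)
      have 2: "v2 * mean p t1 t2 = u2 - 1 / p"
        using m0 by (simp add: v2_def ap)
      \<comment> \<open>By slackness the p-th moment drops out of the exponent, which leaves exactly
        \<open>val\<close>.\<close>
      have 3: "t2 * mean p t1 t2 = t2" using slack by (simp add: algebra_simps)
      show ?thesis by (simp add: m_def left_diff_distrib 1[unfolded mq] 2 3 u val_def ball_exponent_def mq)
    qed
    finally show "ereal (fst u * fst ((z / a) powr q, 1) + snd u * snd ((z / a) powr q, 1)) - Lambda p q u
      \<le> ereal (val t1 t2 (z powr q) + ln a)" by simp
  qed
  then have "I2 p q (z / a) \<le> ereal (val t1 t2 (z powr q) + ln a)"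
    unfolding I2_def using z a pp
    by (simp, intro INF_lower2[where i = "((z / a) powr q, 1)"]) (auto simp: powr_powr)
  then have "ereal (- ln a) + I2 p q (z / a) \<le> ereal (- ln a) + ereal (val t1 t2 (z powr q) + ln a)"
    by (rule add_left_mono)
  then have "I1 a + I2 p q (z / a) \<le> ereal (val t1 t2 (z powr q))" using a a1 by (simp add: I1_def)
  then show ?thesis
    unfolding Irate_def using z a
    by (simp, intro INF_lower2[where i = "(a, z / a)"]) auto
qed

text \<open>By Jensen's inequality against the dilated densities, \<open>w \<mapsto> (w - 1) B - ln w\<close> is minimal at \<open>w = 1\<close>;
  this replaces an integration by parts.\<close>

lemma mean_p_std: "mean p 0 (- (1 / p)) = 1"
proof -
  define B where "B = mean p 0 (- (1 / p))"
  note pp = pq_pos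
  have tangent: "0 \<le> (w - 1) * B - ln w" if w: "w > 0" for w
  proof -
    define a where "a = w powr (1 / p)"
    have a: "a > 0" and ap: "a powr p = w" using w pp by (auto simp: a_def powr_powr)
    have lna: "ln a = ln w / p" using w by (simp add: a_def ln_powr)
    have d: "admissible (0 * a powr q) (- (1 / p) * a powr p)"
      using a pp by (simp add: admissible_def)
    have "ennreal (norm_const * exp ((- w / p + 1 / p) * B)) \<le> nZ 0 (- w / p)"
      using nZ_ge[OF admissible_std, of 0 "- w / p"] by (simp add: B_def norm_const_def)
    also have "nZ 0 (- w / p) = ennreal (norm_const / a)"
      using nZ_eq_Z[OF d] Z_scale[OF a, of 0 "- (1 / p)"] by (simp add: ap norm_const_def)
    finally have "norm_const * exp ((- w / p + 1 / p) * B) \<le> norm_const / a"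
      using norm_const_pos a by (simp add: ennreal_le_iff)
    then have "exp ((- w / p + 1 / p) * B) \<le> exp (- ln a)"
      using norm_const_pos a by (simp add: exp_minus field_simps)
    then have "(- w / p + 1 / p) * B \<le> - ln w / p" by (simp add: lna)
    then have "p * ((- w / p + 1 / p) * B) \<le> p * (- ln w / p)"
      using pp by (intro mult_left_mono) auto
    moreover have "p * ((- w / p + 1 / p) * B) = (1 - w) * B" using pp by (simp add: field_simps)
    moreover have "p * (- ln w / p) = - ln w" using pp by simp
    ultimately have "(1 - w) * B \<le> - ln w" by linarith
    then show ?thesis by (simp add: algebra_simps)
  qed
  have "((\<lambda>w. (w - 1) * B - ln w) has_real_derivative (B - 1)) (at 1)"
    by (auto intro!: derivative_eq_intros)
  then have "B - 1 = 0"
  proof (rule DERIV_local_min)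
    show "\<forall>y. \<bar>1 - y\<bar> < 1 \<longrightarrow> (1 - 1) * B - ln 1 \<le> (y - 1) * B - ln y"
      using tangent by (auto simp: abs_if split: if_splits)
  qed simp
  then show ?thesis by (simp add: B_def)
qed

text \<open>The ratio is invariant under dilations, so by the intermediate value theorem it suffices to know
  its values at the ends of a segment of parameters.\<close>

definition ratio :: "real \<Rightarrow> real \<Rightarrow> real" where
  "ratio t1 t2 = mean q t1 t2 / mean p t1 t2 powr (q / p)"

section \<open>Existence of optimal pairs\<close>

text \<open>The exponent of \<open>ew\<close> is affine along the segment, so every weight on it is
  at most the sum of the two end weights; this one majorant serves the whole segment, ends
  included.\<close>

lemma continuous_on_segment_integral:
  assumes i: "integrable lborel (\<lambda>s. h s * ew u1 u2 s)" "integrable lborel (\<lambda>s. h s * ew v1 v2 s)"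
    and [measurable]: "h \<in> borel_measurable borel"
  shows "continuous_on {0..1}
    (\<lambda>\<theta>. LINT s|lborel. h s * ew ((1 - \<theta>) * u1 + \<theta> * v1) ((1 - \<theta>) * u2 + \<theta> * v2) s)"
proof -
  define e where "e \<theta> = ew ((1 - \<theta>) * u1 + \<theta> * v1) ((1 - \<theta>) * u2 + \<theta> * v2)" for \<theta>
  have [measurable]: "e \<theta> \<in> borel_measurable borel" for \<theta> by (simp add: e_def)
  have bd: "e \<theta> s \<le> ew u1 u2 s + ew v1 v2 s" if "\<theta> \<in> {0..1}" for \<theta> s
  proof -
    define a b where "a = u1 * \<bar>s\<bar> powr q + u2 * \<bar>s\<bar> powr p" and "b = v1 * \<bar>s\<bar> powr q + v2 * \<bar>s\<bar> powr p"
    have "e \<theta> s = exp ((1 - \<theta>) * a + \<theta> * b)"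
      by (simp add: e_def ew_def a_def b_def algebra_simps)
    also have "(1 - \<theta>) * a + \<theta> * b \<le> max a b"
      using that by (intro convex_bound_le) auto
    also have "exp (max a b) \<le> exp a + exp b" by (simp add: max_def)
    finally show ?thesis by (simp add: ew_def a_def b_def)
  qed
  have "continuous_on {0..1} (\<lambda>\<theta>. LINT s|lborel. h s * e \<theta> s)"
    unfolding continuous_on_sequentially
  proof safe
    fix x :: "nat \<Rightarrow> real" and a assume x: "\<forall>n. x n \<in> {0..1}" "x \<longlonglongrightarrow> a"
    have "(\<lambda>n. LINT s|lborel. h s * e (x n) s) \<longlonglongrightarrow> (LINT s|lborel. h s * e a s)"
    proof (rule integral_dominated_convergence)
      show "integrable lborel (\<lambda>s. \<bar>h s * ew u1 u2 s\<bar> + \<bar>h s * ew v1 v2 s\<bar>)" using i by auto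
      show "AE s in lborel. (\<lambda>n. h s * e (x n) s) \<longlonglongrightarrow> h s * e a s"
        unfolding e_def ew_def using x(2) by (intro AE_I2 tendsto_intros)
      fix n
      show "AE s in lborel. norm (h s * e (x n) s) \<le> \<bar>h s * ew u1 u2 s\<bar> + \<bar>h s * ew v1 v2 s\<bar>"
      proof (rule AE_I2)
        fix s
        have "\<bar>h s\<bar> * e (x n) s \<le> \<bar>h s\<bar> * (ew u1 u2 s + ew v1 v2 s)"
          using x bd by (intro mult_left_mono) auto
        then show "norm (h s * e (x n) s) \<le> \<bar>h s * ew u1 u2 s\<bar> + \<bar>h s * ew v1 v2 s\<bar>"
          by (simp add: abs_mult e_def algebra_simps)
      qed
    qed auto
    then show "((\<lambda>\<theta>. LINT s|lborel. h s * e \<theta> s) \<circ> x) \<longlonglongrightarrow> (LINT s|lborel. h s * e a s)"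
      by (simp add: comp_def)
  qed
  then show ?thesis by (simp add: e_def)
qed

lemma admissible_segment:
  assumes "admissible u1 u2" "admissible v1 v2" "0 \<le> \<theta>" "\<theta> \<le> 1"
  shows "admissible ((1 - \<theta>) * u1 + \<theta> * v1) ((1 - \<theta>) * u2 + \<theta> * v2)"
proof -
  have neg: "(1 - \<theta>) * a + \<theta> * b < 0" if "a < 0" "b < 0" for a b :: real
    using convex_bound_lt[of a 0 b "1 - \<theta>" \<theta>] that assms by simp
  consider "\<theta> = 0" | "\<theta> = 1" | "0 < \<theta>" "\<theta> < 1" using assms by linarith
  then show ?thesis
  proof cases
    case 3
    then have "(1 - \<theta>) * u2 \<le> 0" "\<theta> * v2 \<le> 0"
      using admissible_le_0 assms by (auto simp: mult_nonneg_nonpos)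
    moreover have "(1 - \<theta>) * u2 < 0" if "u2 < 0" using 3 that by (simp add: mult_pos_neg)
    moreover have "\<theta> * v2 < 0" if "v2 < 0" using 3 that by (simp add: mult_pos_neg)
    ultimately show ?thesis using neg assms(1,2) unfolding admissible_def by fastforce
  qed (use assms in simp_all)
qed

lemma segment_ratio:
  assumes u: "admissible u1 u2" and v: "admissible v1 v2" and le: "ratio u1 u2 \<le> x" "x \<le> ratio v1 v2"
  obtains \<theta> where "0 \<le> \<theta>" "\<theta> \<le> 1"
    "admissible ((1 - \<theta>) * u1 + \<theta> * v1) ((1 - \<theta>) * u2 + \<theta> * v2)"
    "ratio ((1 - \<theta>) * u1 + \<theta> * v1) ((1 - \<theta>) * u2 + \<theta> * v2) = x"
proof -
  define T1 T2 where "T1 \<theta> = (1 - \<theta>) * u1 + \<theta> * v1" and "T2 \<theta> = (1 - \<theta>) * u2 + \<theta> * v2" for \<theta>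
  have d: "admissible (T1 \<theta>) (T2 \<theta>)" if "\<theta> \<in> {0..1}" for \<theta>
    using admissible_segment[OF u v] that by (simp add: T1_def T2_def)
  have cZ: "continuous_on {0..1} (\<lambda>\<theta>. Z (T1 \<theta>) (T2 \<theta>))"
    using continuous_on_segment_integral[of "\<lambda>_. 1" u1 u2 v1 v2] integrable_ew u v
    by (simp add: Z_def T1_def T2_def)
  have cm: "continuous_on {0..1} (\<lambda>\<theta>. mom r (T1 \<theta>) (T2 \<theta>))" if "r \<ge> 0" for r
    unfolding mom_def T1_def T2_def
    using integrable_powr_ew u v that by (intro continuous_on_segment_integral) auto
  have cmean: "continuous_on {0..1} (\<lambda>\<theta>. mean r (T1 \<theta>) (T2 \<theta>))" if "r \<ge> 0" for r
    unfolding mean_def using cZ cm[OF that] Z_pos[OF d] by (intro continuous_on_divide) (auto simp: less_le)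
  have "continuous_on {0..1} (\<lambda>\<theta>. ratio (T1 \<theta>) (T2 \<theta>))"
    unfolding ratio_def using cmean[of q] cmean[of p] pq_pos mean_pos[OF d, of _ p]
    by (intro continuous_on_divide continuous_on_powr continuous_on_const) (auto simp: less_le)
  then have "\<exists>\<theta>. 0 \<le> \<theta> \<and> \<theta> \<le> 1 \<and> ratio (T1 \<theta>) (T2 \<theta>) = x"
    using le by (intro IVT') (auto simp: T1_def T2_def)
  then show ?thesis using d that by (auto simp: T1_def T2_def)
qed

text \<open>The Kuhn--Tucker conditions, with \<open>t2\<close> as multiplier of the constraint \<open>mean p \<le> 1\<close>.\<close>

definition optimal :: "real \<Rightarrow> real \<Rightarrow> real \<Rightarrow> bool" where
  "optimal t1 t2 x \<longleftrightarrow> admissible t1 t2 \<and> mean q t1 t2 = x \<and> mean p t1 t2 \<le> 1 \<and> t2 * (1 - mean p t1 t2) = 0"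

text \<open>The dilation brings the p-th moment to 1, which makes slackness automatic for every
  \<open>t2\<close>; the q-th moment then becomes the ratio.\<close>

lemma optimal_of_ratio:
  assumes "admissible t1 t2"
  obtains a where "a > 0" "optimal (t1 * a powr q) (t2 * a powr p) (ratio t1 t2)"
proof
  define a where "a = mean p t1 t2 powr (1 / p)"
  have B: "mean p t1 t2 > 0" using mean_pos[OF assms] pq_pos by simp
  show a: "a > 0" using B by (simp add: a_def)
  have "a powr p = mean p t1 t2" "a powr q = mean p t1 t2 powr (q / p)"
    using B pq_pos by (auto simp: a_def powr_powr)
  then show "optimal (t1 * a powr q) (t2 * a powr p) (ratio t1 t2)"
    unfolding optimal_def mean_scale[OF a] using B a assms admissible_scale[of "a powr q" "a powr p" t1 t2]
    by (simp add: ratio_def)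
qed

text \<open>The q-th power of the typical value of the scaled norm, at which \<open>t1\<close>
  changes sign.\<close>

definition xs :: real where "xs = mean q 0 (- (1 / p))"

lemma optimal_std: "optimal 0 (- (1 / p)) xs"
  by (simp add: optimal_def admissible_std mean_p_std xs_def)

lemma ratio_std: "ratio 0 (- (1 / p)) = xs"
  by (simp add: ratio_def mean_p_std xs_def)

lemma xs_pos: "xs > 0"
  unfolding xs_def using mean_pos[OF admissible_std] pq_pos by simp

text \<open>In the first case the constraint is inactive: \<open>t2 = 0\<close>.\<close>

lemma optimal_left:
  assumes "0 < x" "x \<le> xs"
  obtains t1 t2 where "t1 \<le> 0" "optimal t1 t2 x"
proof (cases "x \<le> ratio (- 1) 0")
  case True
  have d: "admissible (- 1) 0" by (simp add: admissible_def)
  define A B where "A = mean q (- 1) 0" and "B = mean p (- 1) 0"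
  have AB: "A > 0" "B > 0" unfolding A_def B_def using mean_pos[OF d] pq_pos by auto
  \<comment> \<open>With \<open>t2 = 0\<close> slackness is free, so the dilation can be spent on
    making the q-th moment equal to \<open>x\<close>; the case assumption says that the p-th moment
    is then at most 1.\<close>
  define a where "a = (A / x) powr (1 / q)"
  have a: "a > 0" using AB assms by (simp add: a_def)
  have aq: "a powr q = A / x" and ap: "a powr p = (A / x) powr (p / q)"
    using AB assms pq_pos by (auto simp: a_def powr_powr)
  have "B powr (q / p) \<le> A / x"
    using True assms AB by (simp add: ratio_def A_def[symmetric] B_def[symmetric] field_simps)
  then have "(B powr (q / p)) powr (p / q) \<le> (A / x) powr (p / q)"
    using pq_pos by (intro powr_mono2) auto
  then have "B \<le> a powr p" using AB pq_pos by (simp add: powr_powr ap)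
  then have "optimal (- 1 * a powr q) (0 * a powr p) x"
    using d a AB assms admissible_scale[of "a powr q" "a powr p" "-1" 0] aq mean_scale[OF a, of _ "- 1" 0]
    by (simp add: optimal_def A_def[symmetric] B_def[symmetric] admissible_def)
  then show ?thesis using that[of "- 1 * a powr q" "0 * a powr p"] by simp
next
  case False
  \<comment> \<open>Both ends have \<open>t1 \<le> 0\<close>, hence so does the segment between
    them; its ratios cover the values left over, up to \<open>xs\<close>.\<close>
  then obtain \<theta> where th: "0 \<le> \<theta>" "\<theta> \<le> 1"
    "admissible ((1 - \<theta>) * (- 1) + \<theta> * 0) ((1 - \<theta>) * 0 + \<theta> * (- (1 / p)))"
    "ratio ((1 - \<theta>) * (- 1) + \<theta> * 0) ((1 - \<theta>) * 0 + \<theta> * (- (1 / p))) = x"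
    using segment_ratio[of "- 1" 0 0 "- (1 / p)" x] admissible_std assms ratio_std by (auto simp: admissible_def)
  obtain a where a: "a > 0" "optimal (((1 - \<theta>) * (- 1) + \<theta> * 0) * a powr q)
      (((1 - \<theta>) * 0 + \<theta> * (- (1 / p))) * a powr p) x"
    using optimal_of_ratio[OF th(3)] th(4) by metis
  show ?thesis
    by (rule that[OF _ a(2)]) (use th in \<open>auto simp: mult_nonpos_nonneg\<close>)
qed

section \<open>Parameters for the approach to z = 1\<close>

text \<open>The maximum over \<open>s\<close> of
  \<open>\<bar>s\<bar> powr q / q - \<bar>s\<bar> powr p / p\<close>, attained at
  \<open>\<bar>s\<bar> = 1\<close>. Along the ray \<open>(l / q, - (l / p))\<close> the weights
  concentrate there as \<open>l\<close> grows.\<close>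

definition peak :: real where "peak = 1 / q - 1 / p"

lemma peak_pos: "peak > 0"
  using pq_pos q_less_p by (simp add: peak_def field_simps)

text \<open>Weighted AM-GM with its defect: apply \<open>u powr \<alpha> \<le> \<alpha> u + 1 - \<alpha>\<close> to \<open>u = sqrt y\<close> and square.\<close>

lemma peak_defect:
  "\<bar>s\<bar> powr q / q - \<bar>s\<bar> powr p / p \<le> peak - (1 - q / p) / p * (\<bar>s\<bar> powr (p / 2) - 1)\<^sup>2"
proof -
  define \<alpha> where "\<alpha> = q / p"
  define u where "u = \<bar>s\<bar> powr (p / 2)"
  have al: "0 < \<alpha>" "\<alpha> < 1" using pq_pos q_less_p by (auto simp: \<alpha>_def)
  have u: "u \<ge> 0" by (simp add: u_def)
  have "u powr \<alpha> \<le> \<alpha> * u + (1 - \<alpha>)"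
    using Youngs_inequality_0[of \<alpha> "1 - \<alpha>" u 1] al u by (cases "u = 0") auto
  then have "(u powr \<alpha>)\<^sup>2 \<le> (\<alpha> * u + (1 - \<alpha>))\<^sup>2" by (intro power_mono) auto
  moreover have "(u powr \<alpha>)\<^sup>2 = \<bar>s\<bar> powr q"
    using pq_pos by (simp add: u_def \<alpha>_def powr_powr power2_eq_square flip: powr_add)
  moreover have "u\<^sup>2 = \<bar>s\<bar> powr p"
    by (simp add: u_def power2_eq_square flip: powr_add)
  \<comment> \<open>Squaring the mean of \<open>u\<close> and 1 with weights \<open>\<alpha>\<close>
    and \<open>1 - \<alpha>\<close> loses their variance, which is the defect term.\<close>
  moreover have "(\<alpha> * u + (1 - \<alpha>))\<^sup>2 = \<alpha> * u\<^sup>2 + (1 - \<alpha>) - \<alpha> * (1 - \<alpha>) * (u - 1)\<^sup>2"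
    by (simp add: power2_eq_square algebra_simps)
  ultimately have "\<bar>s\<bar> powr q \<le> \<alpha> * \<bar>s\<bar> powr p + (1 - \<alpha>) - \<alpha> * (1 - \<alpha>) * (u - 1)\<^sup>2" by simp
  then have "\<bar>s\<bar> powr q / q \<le> (\<alpha> * \<bar>s\<bar> powr p + (1 - \<alpha>) - \<alpha> * (1 - \<alpha>) * (u - 1)\<^sup>2) / q"
    using pq_pos by (intro divide_right_mono) auto
  also have "\<dots> = \<alpha> / q * \<bar>s\<bar> powr p + (1 - \<alpha>) / q - \<alpha> / q * (1 - \<alpha>) * (u - 1)\<^sup>2"
    by (simp add: add_divide_distrib diff_divide_distrib)
  also have "\<alpha> / q = 1 / p" using pq_pos by (simp add: \<alpha>_def)
  also have "(1 - \<alpha>) / q = peak" using pq_pos by (simp add: \<alpha>_def peak_def diff_divide_distrib)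
  finally show ?thesis by (simp add: u_def \<alpha>_def)
qed

lemma peak_le: "\<bar>s\<bar> powr q / q - \<bar>s\<bar> powr p / p \<le> peak"
  using peak_defect[of s] q_less_p pq_pos
  by (smt (verit) divide_nonneg_pos divide_le_eq_1_pos mult_nonneg_nonneg zero_le_power2)

lemma admissible_peak: "l > 0 \<Longrightarrow> admissible (l / q) (- (l / p))"
  using pq_pos by (simp add: admissible_def)

text \<open>A Laplace-type bound: just to the right of \<open>s = 1\<close> the exponent exceeds
  \<open>peak - \<epsilon>\<close>, and \<open>\<delta>\<close> is the length of that interval, the
  same for all \<open>l\<close>.\<close>

lemma Z_peak_ge:
  assumes "0 < \<epsilon>"
  obtains \<delta> where "\<delta> > 0" "\<And>l. l > 0 \<Longrightarrow> \<delta> * exp (l * (peak - \<epsilon>)) \<le> Z (l / q) (- (l / p))"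
proof -
  have "((\<lambda>s. \<bar>s\<bar> powr q / q - \<bar>s\<bar> powr p / p) \<longlongrightarrow> \<bar>1\<bar> powr q / q - \<bar>1\<bar> powr p / p) (at_right 1)"
    using pq_pos by (intro tendsto_intros) auto
  moreover have "peak - \<epsilon> < \<bar>1\<bar> powr q / q - \<bar>1\<bar> powr p / p" using assms by (simp add: peak_def)
  ultimately have "\<forall>\<^sub>F s in at_right 1. peak - \<epsilon> < \<bar>s\<bar> powr q / q - \<bar>s\<bar> powr p / p"
    by (rule order_tendstoD)
  then obtain b where b: "b > 1" "\<And>s. 1 < s \<Longrightarrow> s < b \<Longrightarrow> peak - \<epsilon> < \<bar>s\<bar> powr q / q - \<bar>s\<bar> powr p / p"
    by (auto simp: eventually_at_right_field)
  show ?thesis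
  proof
    show "b - 1 > 0" using b by simp
    fix l :: real assume l: "l > 0"
    have "(b - 1) * exp (l * (peak - \<epsilon>)) = (LINT s|lborel. exp (l * (peak - \<epsilon>)) * indicator {1<..<b} s)"
      using b by (simp add: mult.commute)
    also have "\<dots> \<le> (LINT s|lborel. ew (l / q) (- (l / p)) s)"
    proof (rule integral_mono)
      show "integrable lborel (\<lambda>s. exp (l * (peak - \<epsilon>)) * indicator {1<..<b} s)"
        using b(1) by (auto intro!: integrable_real_indicator)
      show "integrable lborel (ew (l / q) (- (l / p)))" by (intro integrable_ew admissible_peak l)
      fix s
      have "l * (peak - \<epsilon>) \<le> l * (\<bar>s\<bar> powr q / q - \<bar>s\<bar> powr p / p)" if "s \<in> {1<..<b}"
        using b(2)[of s] that l by (intro mult_left_mono) auto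
      then show "exp (l * (peak - \<epsilon>)) * indicator {1<..<b} s \<le> ew (l / q) (- (l / p)) s"
        by (simp add: ew_def indicator_def algebra_simps)
    qed
    finally show "(b - 1) * exp (l * (peak - \<epsilon>)) \<le> Z (l / q) (- (l / p))" by (simp add: Z_def)
  qed
qed

text \<open>Given the p-th moment \<open>B\<close>, the ratio caps the q-th moment at
  \<open>x * B powr (q / p)\<close>; rescaling reduces the rest to the pointwise bound
  \<open>peak_le\<close>.\<close>

lemma peak_means_le:
  assumes t: "admissible t1 t2" and r: "ratio t1 t2 \<le> x"
  shows "mean q t1 t2 / q - mean p t1 t2 / p \<le> x powr (p / (p - q)) * peak"
proof -
  define B where "B = mean p t1 t2"
  have B: "B > 0" unfolding B_def using mean_pos[OF t] pq_pos by simp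
  have "ratio t1 t2 > 0" unfolding ratio_def using mean_pos[OF t, of q] mean_pos[OF t, of p] pq_pos by (intro divide_pos_pos) auto
  then have x: "x > 0" using r by simp
  \<comment> \<open>Solves \<open>B = c * s powr p\<close> and
    \<open>x * B powr (q / p) = c * s powr q\<close> with the common factor
    \<open>c = x powr (p / (p - q))\<close>.\<close>
  define s where "s = B powr (1 / p) * x powr (- 1 / (p - q))"
  have s: "s > 0" using B x by (simp add: s_def)
  have "mean q t1 t2 \<le> x * B powr (q / p)" using r B by (simp add: ratio_def B_def[symmetric] field_simps)
  then have "mean q t1 t2 / q - B / p \<le> x * B powr (q / p) / q - B / p"
    using pq_pos by (simp add: divide_right_mono)
  also have "x * B powr (q / p) = x powr (p / (p - q)) * s powr q"
  proof -
    have "x powr (p / (p - q)) * s powr q = B powr (q / p) * (x powr (p / (p - q)) * x powr (- q / (p - q)))"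
      using B x pq_pos by (simp add: s_def powr_mult powr_powr)
    also have "x powr (p / (p - q)) * x powr (- q / (p - q)) = x powr 1"
      using q_less_p by (simp flip: powr_add diff_divide_distrib)
    finally show ?thesis using x by simp
  qed
  also have "x powr (p / (p - q)) * s powr q / q - B / p
      = x powr (p / (p - q)) * s powr q / q - x powr (p / (p - q)) * s powr p / p"
  proof -
    have "x powr (p / (p - q)) * s powr p = B * (x powr (p / (p - q)) * x powr (- p / (p - q)))"
      using B x pq_pos by (simp add: s_def powr_mult powr_powr)
    also have "x powr (p / (p - q)) * x powr (- p / (p - q)) = 1"
      using x by (simp flip: powr_add)
    finally show ?thesis by simp
  qed
  also have "\<dots> = x powr (p / (p - q)) * (\<bar>s\<bar> powr q / q - \<bar>s\<bar> powr p / p)"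
    using s by (simp add: right_diff_distrib)
  also have "\<dots> \<le> x powr (p / (p - q)) * peak" by (intro mult_left_mono peak_le) auto
  finally show ?thesis by (simp add: B_def)
qed

text \<open>Jensen's inequality between the parameters \<open>l\<close> and \<open>1\<close> on the ray forces \<open>mean q / q - mean p / p\<close> to
  approach \<open>peak\<close> for large \<open>l\<close>, which a ratio bounded away from 1 excludes.\<close>

lemma ratio_peak_ge:
  assumes "0 < x" "x < 1"
  obtains l where "l > 0" "x \<le> ratio (l / q) (- (l / p))"
proof (rule ccontr)
  assume "\<not> thesis"
  then have small: "ratio (l / q) (- (l / p)) \<le> x" if "l > 0" for l
    using that \<open>\<And>l. 0 < l \<Longrightarrow> x \<le> ratio (l / q) (- (l / p)) \<Longrightarrow> thesis\<close> by force
  \<comment> \<open>\<open>2 * \<epsilon>\<close> is the distance from \<open>peak\<close> to the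
    bound of \<open>peak_means_le\<close>, while \<open>Z_peak_ge\<close> loses only
    \<open>\<epsilon>\<close>; the surplus \<open>l * \<epsilon>\<close> outgrows every
    constant.\<close>
  define \<epsilon> where "\<epsilon> = (1 - x powr (p / (p - q))) * peak / 2"
  have "x powr (p / (p - q)) < 1 powr (p / (p - q))"
    using assms pq_pos q_less_p by (intro powr_less_mono2) auto
  then have \<epsilon>: "\<epsilon> > 0" using peak_pos by (simp add: \<epsilon>_def)
  have xe: "x powr (p / (p - q)) * peak = peak - 2 * \<epsilon>" by (simp add: \<epsilon>_def field_simps)
  obtain \<delta> where \<delta>: "\<delta> > 0" "\<And>l. l > 0 \<Longrightarrow> \<delta> * exp (l * (peak - \<epsilon>)) \<le> Z (l / q) (- (l / p))"
    using Z_peak_ge[OF \<epsilon>] by blast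
  define Z1 where "Z1 = Z (1 / q) (- (1 / p))"
  have Z1: "Z1 > 0" unfolding Z1_def by (intro Z_pos admissible_peak) simp
  have key: "ln \<delta> + l * (peak - \<epsilon>) - (l - 1) * (peak - 2 * \<epsilon>) \<le> ln Z1" if l: "l > 1" for l
  proof -
    have d: "admissible (l / q) (- (l / p))" using l by (intro admissible_peak) simp
    define m where "m = mean q (l / q) (- (l / p)) / q - mean p (l / q) (- (l / p)) / p"
    have m: "m \<le> peak - 2 * \<epsilon>"
      using peak_means_le[OF d small] l by (simp add: m_def xe)
    have "ennreal (Z (l / q) (- (l / p)) * exp ((1 - l) * m)) \<le> nZ (1 / q) (- (1 / p))"
      using nZ_ge[OF d, of "1 / q" "- (1 / p)"] by (simp add: m_def algebra_simps diff_divide_distrib)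
    also have "\<dots> = ennreal Z1" unfolding Z1_def by (intro nZ_eq_Z admissible_peak) simp
    finally have "Z (l / q) (- (l / p)) * exp ((1 - l) * m) \<le> Z1" using Z1 by (simp add: ennreal_le_iff)
    moreover have "\<delta> * exp (l * (peak - \<epsilon>)) * exp ((1 - l) * m) \<le> Z (l / q) (- (l / p)) * exp ((1 - l) * m)"
      using \<delta>(2)[of l] l by (intro mult_right_mono) auto
    ultimately have "\<delta> * exp (l * (peak - \<epsilon>)) * exp ((1 - l) * m) \<le> Z1" by linarith
    then have "ln (\<delta> * exp (l * (peak - \<epsilon>)) * exp ((1 - l) * m)) \<le> ln Z1"
      using \<delta>(1) Z1 by (subst ln_le_cancel_iff) auto
    then have "ln \<delta> + l * (peak - \<epsilon>) + (1 - l) * m \<le> ln Z1" using \<delta>(1) by (simp add: ln_mult)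
    moreover have "(1 - l) * (peak - 2 * \<epsilon>) \<le> (1 - l) * m" using m l by (intro mult_left_mono_neg) auto
    ultimately show ?thesis by (simp add: algebra_simps)
  qed
  \<comment> \<open>The quotient makes \<open>key\<close> fail by at least 1, and the 2 secures
    \<open>l > 1\<close>.\<close>
  define l where "l = max 2 ((ln Z1 - ln \<delta> - peak + 2 * \<epsilon> + 1) / \<epsilon>)"
  have "l > 1" "(ln Z1 - ln \<delta> - peak + 2 * \<epsilon> + 1) / \<epsilon> \<le> l" by (auto simp: l_def)
  then have "ln Z1 - ln \<delta> - peak + 2 * \<epsilon> + 1 \<le> l * \<epsilon>" using \<epsilon> by (simp add: field_simps)
  with key[OF \<open>l > 1\<close>] show False by (simp add: algebra_simps)
qed

lemma optimal_right:
  assumes "xs \<le> x" "x < 1"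
  obtains t1 t2 where "t1 \<ge> 0" "optimal t1 t2 x"
proof -
  have "0 < x" using assms xs_pos by simp
  then obtain l where l: "l > 0" "x \<le> ratio (l / q) (- (l / p))" using ratio_peak_ge assms by blast
  obtain \<theta> where th: "0 \<le> \<theta>" "\<theta> \<le> 1"
    "admissible ((1 - \<theta>) * 0 + \<theta> * (l / q)) ((1 - \<theta>) * (- (1 / p)) + \<theta> * (- (l / p)))"
    "ratio ((1 - \<theta>) * 0 + \<theta> * (l / q)) ((1 - \<theta>) * (- (1 / p)) + \<theta> * (- (l / p))) = x"
    using segment_ratio[OF admissible_std admissible_peak[OF l(1)], of x] assms ratio_std l by auto
  obtain a where a: "a > 0" "optimal (((1 - \<theta>) * 0 + \<theta> * (l / q)) * a powr q)
      (((1 - \<theta>) * (- (1 / p)) + \<theta> * (- (l / p))) * a powr p) x"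
    using optimal_of_ratio[OF th(3)] th(4) by metis
  show ?thesis
    by (rule that[OF _ a(2)]) (use th l pq_pos in auto)
qed

section \<open>Unbounded exponents at the two ends, and the choice of multipliers\<close>

text \<open>At \<open>x = 1\<close> the exponent is, up to a constant, minus the logarithm of
  \<open>exp (- l * peak) * Z\<close>. This is the integral of the l-th power of a function below 1
  off \<open>\<bar>s\<bar> = 1\<close>, so it tends to 0 by dominated convergence. Larger
  \<open>x\<close> only help because \<open>t1 > 0\<close>.\<close>

lemma val_peak_unbounded: "\<exists>l > 0. \<forall>x \<ge> 1. C \<le> val (l / q) (- (l / p)) x"
proof -
  \<comment> \<open>The shift by 1 starts the powers at \<open>l = 1\<close>, so that
    \<open>f 0\<close> is integrable and dominates the sequence.\<close>
  define f where "f n s = exp ((real n + 1) * (\<bar>s\<bar> powr q / q - \<bar>s\<bar> powr p / p - peak))" for n s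
  have fe: "f n s = exp (- (real n + 1) * peak) * ew ((real n + 1) / q) (- ((real n + 1) / p)) s" for n s
    by (simp add: f_def ew_def algebra_simps flip: exp_add)
  have fi: "integrable lborel (f n)" for n
    unfolding fe using integrable_ew[OF admissible_peak[of "real n + 1"]] by auto
  have "(\<lambda>n. LINT s|lborel. f n s) \<longlonglongrightarrow> (LINT (s::real)|lborel. 0::real)"
  proof (rule integral_dominated_convergence)
    show "integrable lborel (f 0)" by (rule fi)
    have "(\<lambda>n. f n s) \<longlonglongrightarrow> 0" if "s \<noteq> 1" "s \<noteq> -1" for s
    proof -
      have "\<bar>s\<bar> powr (p / 2) \<noteq> 1"
      proof
        assume "\<bar>s\<bar> powr (p / 2) = 1"
        then have "(\<bar>s\<bar> powr (p / 2)) powr (2 / p) = 1" by simp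
        then show False using pq_pos that by (simp add: powr_powr)
      qed
      then have "0 < (1 - q / p) / p * (\<bar>s\<bar> powr (p / 2) - 1)\<^sup>2"
        using pq_pos q_less_p by (intro mult_pos_pos) (auto simp: zero_less_power2)
      then have neg: "\<bar>s\<bar> powr q / q - \<bar>s\<bar> powr p / p - peak < 0" using peak_defect[of s] by linarith
      then show ?thesis unfolding f_def by real_asymp
    qed
    moreover have "AE s in lborel. s \<noteq> (1::real)" "AE s in lborel. s \<noteq> (-1::real)"
      by (rule AE_lborel_singleton)+
    ultimately show "AE s in lborel. (\<lambda>n. f n s) \<longlonglongrightarrow> 0"
      by (auto elim: eventually_elim2)
    show "AE s in lborel. norm (f n s) \<le> f 0 s" for n
    proof (rule AE_I2)
      fix s
      have "(real n + 1) * (\<bar>s\<bar> powr q / q - \<bar>s\<bar> powr p / p - peak) \<le> 1 * (\<bar>s\<bar> powr q / q - \<bar>s\<bar> powr p / p - peak)"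
        using peak_le[of s] by (intro mult_right_mono_neg) auto
      then show "norm (f n s) \<le> f 0 s" by (simp add: f_def)
    qed
  qed (use fi in auto)
  then have "(\<lambda>n. LINT s|lborel. f n s) \<longlonglongrightarrow> 0" by simp
  then have "\<forall>\<^sub>F n in sequentially. (LINT s|lborel. f n s) < exp (ball_exponent - C)"
    by (rule order_tendstoD) simp
  then obtain n where n: "(LINT s|lborel. f n s) < exp (ball_exponent - C)" by (auto simp: eventually_sequentially)
  define l where "l = real n + 1"
  have l: "l > 0" by (simp add: l_def)
  have Zp: "Z (l / q) (- (l / p)) > 0" using Z_pos admissible_peak l by blast
  have "(LINT s|lborel. f n s) = exp (- l * peak) * Z (l / q) (- (l / p))"
    unfolding fe by (simp add: Z_def l_def)
  with n have "ln (exp (- l * peak) * Z (l / q) (- (l / p))) < ln (exp (ball_exponent - C))"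
    using Zp by (subst ln_less_cancel_iff) auto
  then have "C \<le> val (l / q) (- (l / p)) 1"
    using Zp by (simp add: ln_mult val_def peak_def algebra_simps)
  moreover have "val (l / q) (- (l / p)) 1 \<le> val (l / q) (- (l / p)) x" if "x \<ge> 1" for x
    using mult_left_mono[OF that, of "l / q"] l pq_pos by (simp add: val_def)
  ultimately show ?thesis using l by force
qed

text \<open>With \<open>t2 = 0\<close>, a dilation by \<open>a\<close> divides \<open>Z\<close> by
  \<open>a\<close>, and at \<open>x = 0\<close> its only effect on the exponent is to add
  \<open>ln a\<close>.\<close>

lemma val_left_unbounded: "\<exists>t1 < 0. C \<le> val t1 0 0"
proof -
  have d: "admissible (- 1) 0" by (simp add: admissible_def)
  define a where "a = exp (C - ball_exponent + ln (Z (- 1) 0))"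
  have a: "a > 0" by (simp add: a_def)
  have "val (- 1 * a powr q) (0 * a powr p) 0 = ball_exponent - ln (Z (- 1) 0) + ln a"
    unfolding val_def Z_scale[OF a] using Z_pos[OF d] a by (simp add: ln_div)
  then have "val (- (a powr q)) 0 0 = C" by (simp add: a_def)
  then show ?thesis using a by (intro exI[of _ "- (a powr q)"]) auto
qed

lemma Irate_0: "Irate p q 0 = \<infinity>"
proof (rule ereal_top)
  fix C
  obtain t1 where "t1 < 0" "C \<le> val t1 0 0" using val_left_unbounded by blast
  then show "ereal C \<le> Irate p q 0"
    using val_le_Irate[of 0 t1 0] by (auto simp: admissible_def intro: order_trans[rotated])
qed

lemma Irate_ge_1:
  assumes "z \<ge> 1"
  shows "Irate p q z = \<infinity>"
proof (rule ereal_top)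
  fix C
  obtain l where "l > 0" "\<forall>x\<ge>1. C \<le> val (l / q) (- (l / p)) x" using val_peak_unbounded by blast
  moreover have "z powr q \<ge> 1" using assms pq_pos by (simp add: ge_one_powr_ge_zero)
  ultimately show "ereal C \<le> Irate p q z"
    using val_le_Irate[of z "l / q" "- (l / p)"] assms admissible_peak by (auto intro: order_trans[rotated])
qed

lemma Irate_optimal:
  assumes "optimal t1 t2 (z powr q)" "0 \<le> z"
  shows "Irate p q z = ereal (val t1 t2 (z powr q))"
  using assms val_le_Irate Irate_le_val by (auto simp: optimal_def intro!: antisym)

text \<open>A soft argument in place of a strict power-mean inequality: otherwise an optimal pair
  would exist at 1 and make the rate finite there.\<close>

lemma xs_less_1: "xs < 1"
proof (rule ccontr)
  assume "\<not> xs < 1"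
  then have "1 \<le> xs" by simp
  then obtain t1 t2 where "optimal t1 t2 1" using optimal_left[of 1] by (metis zero_less_one)
  then have "Irate p q 1 = ereal (val t1 t2 (1 powr q))" by (intro Irate_optimal) auto
  then show False using Irate_ge_1[of 1] by simp
qed

definition zs :: real where "zs = xs powr (1 / q)"

lemma zs: "0 < zs" "zs < 1" "zs powr q = xs"
proof -
  show "0 < zs" using xs_pos by (simp add: zs_def)
  show "zs powr q = xs" using xs_pos pq_pos by (simp add: zs_def powr_powr)
  have "xs powr (1 / q) < 1 powr (1 / q)" using xs_pos xs_less_1 pq_pos by (intro powr_less_mono2) auto
  then show "zs < 1" by (simp add: zs_def)
qed

text \<open>The sign of \<open>t1\<close> is the one that suits events to the left of
  \<open>z\<close>. Moments are positive, so \<open>z = 0\<close> has no optimal pair, and a pair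
  from \<open>val_left_unbounded\<close> takes its place.\<close>

lemma multiplier_left:
  assumes "ereal \<alpha> < Irate p q z" "0 \<le> z" "z \<le> zs"
  obtains t1 t2 where "t1 \<le> 0" "admissible t1 t2" "\<alpha> \<le> val t1 t2 (z powr q)"
proof (cases "z = 0")
  case True
  obtain t1 where "t1 < 0" "\<alpha> \<le> val t1 0 0" using val_left_unbounded by blast
  then show ?thesis using that[of t1 0] True by (simp add: admissible_def)
next
  case False
  have "z powr q \<le> zs powr q" using assms pq_pos by (intro powr_mono2) auto
  then obtain t1 t2 where t: "t1 \<le> 0" "optimal t1 t2 (z powr q)"
    using optimal_left[of "z powr q"] False assms zs by auto
  then show ?thesis using that[of t1 t2] assms Irate_optimal[OF t(2)] by (simp add: optimal_def)
qed

lemma multiplier_right: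
  assumes "ereal \<alpha> < Irate p q z" "zs \<le> z"
  obtains t1 t2 where "t1 \<ge> 0" "admissible t1 t2" "\<alpha> \<le> val t1 t2 (z powr q)"
proof (cases "z < 1")
  case False
  obtain l where l: "l > 0" "\<forall>x\<ge>1. \<alpha> \<le> val (l / q) (- (l / p)) x" using val_peak_unbounded by blast
  moreover have "z powr q \<ge> 1" using False pq_pos by (simp add: ge_one_powr_ge_zero)
  ultimately show ?thesis using that[of "l / q" "- (l / p)"] admissible_peak[OF l(1)] pq_pos by simp
next
  case True
  have "zs powr q \<le> z powr q" using assms zs(1) pq_pos by (intro powr_mono2) auto
  moreover have "z powr q < 1 powr q" using assms zs(1) True pq_pos by (intro powr_less_mono2) auto
  ultimately obtain t1 t2 where t: "t1 \<ge> 0" "optimal t1 t2 (z powr q)"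
    using optimal_right[of "z powr q"] zs by auto
  then show ?thesis using that[of t1 t2] assms zs(1) Irate_optimal[OF t(2)] by (simp add: optimal_def)
qed

lemma Irate_finite_optimal:
  assumes "Irate p q z < \<infinity>"
  obtains t1 t2 where "0 < z" "z < 1" "optimal t1 t2 (z powr q)"
proof -
  have "z \<ge> 0" using assms by (auto simp: Irate_def split: if_splits)
  moreover have "z \<noteq> 0" using assms Irate_0 by auto
  moreover have z1: "z < 1" using assms Irate_ge_1[of z] by force
  ultimately have z: "z > 0" by simp
  then have "z powr q < 1 powr q" using z1 pq_pos by (intro powr_less_mono2) auto
  then show ?thesis
    using optimal_left[of "z powr q"] optimal_right[of "z powr q"] z z1 that
    by (cases "z powr q \<le> xs") auto
qed

end

section \<open>Volume estimates in dimension n\<close>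

text \<open>Expand the square over pairs of indices. Each summand is a product over coordinates; off
  the diagonal it has a factor \<open>w * h\<close> of integral 0, and the diagonal yields
  \<open>card I\<close> equal second moments.\<close>

lemma (in product_sigma_finite) second_moment_sum:
  fixes w h :: "'a \<Rightarrow> real" and N :: "'a measure" and I :: "'i set"
  assumes M: "\<And>i. M i = N" and fin: "finite I"
    and i: "integrable N w" "integrable N (\<lambda>s. w s * h s)" "integrable N (\<lambda>s. w s * (h s)\<^sup>2)"
    and w1: "(LINT s|N. w s) = 1" and wh: "(LINT s|N. w s * h s) = 0"
  shows "integrable (Pi\<^sub>M I M) (\<lambda>x. (\<Prod>i\<in>I. w (x i)) * (\<Sum>i\<in>I. h (x i))\<^sup>2)" (is ?A)
    and "(LINT x|Pi\<^sub>M I M. (\<Prod>i\<in>I. w (x i)) * (\<Sum>i\<in>I. h (x i))\<^sup>2)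
      = card I * (LINT s|N. w s * (h s)\<^sup>2)" (is ?B)
proof -
  \<comment> \<open>The \<open>k\<close>-th factor of the summand \<open>(i, j)\<close>; for
    \<open>i = j = k\<close> it carries \<open>h s\<close> twice.\<close>
  define g where "g i j k s = w s * (if k = i then h s else 1) * (if k = j then h s else 1)"
    for i j k :: 'i and s
  have gi: "integrable (M k) (g i j k)" for i j k
    unfolding M g_def using i
    by (cases "k = i"; cases "k = j") (simp_all add: power2_eq_square mult.assoc)
  have eq: "(\<Prod>i\<in>I. w (x i)) * (\<Sum>i\<in>I. h (x i))\<^sup>2 = (\<Sum>i\<in>I. \<Sum>j\<in>I. \<Prod>k\<in>I. g i j k (x k))" for x
  proof -
    have "(\<Prod>k\<in>I. g i j k (x k)) = (\<Prod>k\<in>I. w (x k)) * h (x i) * h (x j)" if "i \<in> I" "j \<in> I" for i j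
      using that fin by (simp add: g_def prod.distrib)
    moreover have "(\<Sum>i\<in>I. h (x i))\<^sup>2 = (\<Sum>i\<in>I. \<Sum>j\<in>I. h (x i) * h (x j))"
      by (simp only: power2_eq_square sum_product)
    ultimately show ?thesis
      by (simp add: sum_distrib_left mult.assoc)
  qed
  show ?A unfolding eq
    by (intro Bochner_Integration.integrable_sum product_integrable_prod fin gi)
  have Eg: "(\<Prod>k\<in>I. LINT s|M k. g i j k s) = (if i = j then LINT s|N. w s * (h s)\<^sup>2 else 0)"
    if "i \<in> I" "j \<in> I" for i j
  proof (cases "i = j")
    case True
    have "(LINT s|M k. g i j k s) = (if k = i then LINT s|N. w s * (h s)\<^sup>2 else 1)" for k
      using True w1 by (simp add: M g_def power2_eq_square mult.assoc)
    then show ?thesis using True that fin by simp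
  next
    case False
    then have "(LINT s|M i. g i j i s) = 0" using wh by (simp add: M g_def)
    then show ?thesis using False that fin by (auto intro!: prod_zero)
  qed
  have "(LINT x|Pi\<^sub>M I M. (\<Sum>i\<in>I. \<Sum>j\<in>I. \<Prod>k\<in>I. g i j k (x k)))
    = (\<Sum>i\<in>I. \<Sum>j\<in>I. \<Prod>k\<in>I. LINT s|M k. g i j k s)"
    by (simp add: product_integrable_prod product_integral_prod fin gi)
  also have "\<dots> = (\<Sum>i\<in>I. \<Sum>j\<in>I. if i = j then LINT s|N. w s * (h s)\<^sup>2 else 0)"
    by (intro sum.cong refl Eg)
  also have "\<dots> = card I * (LINT s|N. w s * (h s)\<^sup>2)" using fin by simp
  finally show ?B unfolding eq .
qed

interpretation lborel_product: product_sigma_finite "\<lambda>_::nat. lborel :: real measure"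
  by standard

lemma measurable_component_lebesgue_n [measurable]:
  "i < n \<Longrightarrow> (\<lambda>x. x i) \<in> borel_measurable (lebesgue_n n)"
  unfolding lebesgue_n_def using measurable_component_singleton[of i "{..<n}" "\<lambda>_. lborel"] by simp

lemma measurable_coordinate_sum [measurable]:
  assumes [measurable]: "f \<in> borel_measurable borel"
  shows "(\<lambda>x. \<Sum>i<n. f (x i) :: real) \<in> borel_measurable (lebesgue_n n)"
  by (intro borel_measurable_sum measurable_compose[OF measurable_component_lebesgue_n]) auto

text \<open>Chebyshev for both sums at once, with the product of \<open>w\<close> as density:
  pointwise the indicator of \<open>G\<close> is at least
  \<open>1 - (a\<^sup>2 + b\<^sup>2) / d\<close>, so one integration suffices.\<close>

lemma chebyshev_product:
  fixes w h k :: "real \<Rightarrow> real" and \<epsilon> :: real and n :: nat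
  assumes ih: "integrable lborel (\<lambda>s. w s * h s)" "integrable lborel (\<lambda>s. w s * (h s)\<^sup>2)"
    and ik: "integrable lborel (\<lambda>s. w s * k s)" "integrable lborel (\<lambda>s. w s * (k s)\<^sup>2)"
    and iw: "integrable lborel w"
    and w1: "(LINT s|lborel. w s) = 1" and wh: "(LINT s|lborel. w s * h s) = 0"
    and wk: "(LINT s|lborel. w s * k s) = 0"
    and w0: "\<And>s. w s \<ge> 0" and n: "n > 0" and \<epsilon>: "\<epsilon> > 0"
    and [measurable]: "h \<in> borel_measurable borel" "k \<in> borel_measurable borel"
  defines "G \<equiv> {x \<in> space (lebesgue_n n). \<bar>\<Sum>i<n. h (x i)\<bar> < n * \<epsilon> \<and> \<bar>\<Sum>i<n. k (x i)\<bar> < n * \<epsilon>}"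
  shows "1 - ((LINT s|lborel. w s * (h s)\<^sup>2) + (LINT s|lborel. w s * (k s)\<^sup>2)) / (n * \<epsilon>\<^sup>2)
    \<le> (LINT x|lebesgue_n n. (\<Prod>i<n. w (x i)) * indicator G x)"
    and "integrable (lebesgue_n n) (\<lambda>x. (\<Prod>i<n. w (x i)) * indicator G x)"
proof -
  let ?L = "lebesgue_n n"
  let ?P = "\<lambda>x. \<Prod>i<n. w (x i)"
  have [measurable]: "G \<in> sets ?L" unfolding G_def by measurable
  have Pi: "integrable ?L ?P"
    unfolding lebesgue_n_def by (intro lborel_product.product_integrable_prod iw) auto
  have P1: "(LINT x|?L. ?P x) = 1"
    unfolding lebesgue_n_def using w1 iw by (subst lborel_product.product_integral_prod) auto
  note H = lborel_product.second_moment_sum[OF refl finite_lessThan iw ih w1 wh, of n, folded lebesgue_n_def]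
  note K = lborel_product.second_moment_sum[OF refl finite_lessThan iw ik w1 wk, of n, folded lebesgue_n_def]
  define d where "d = (real n * \<epsilon>)\<^sup>2"
  have d: "d > 0" using n \<epsilon> by (simp add: d_def)
  have P0: "?P x \<ge> 0" for x by (intro prod_nonneg) (auto simp: w0)
  show int: "integrable ?L (\<lambda>x. ?P x * indicator G x)"
    using integrable_mult_indicator[OF _ Pi, of G] by (simp add: mult.commute)
  have iR: "integrable ?L (\<lambda>x. ?P x - (?P x * (\<Sum>i<n. h (x i))\<^sup>2 + ?P x * (\<Sum>i<n. k (x i))\<^sup>2) / d)"
    using Pi H(1) K(1) by (intro Bochner_Integration.integrable_diff integrable_divide_zero
      Bochner_Integration.integrable_add) auto
  have "1 - ((LINT s|lborel. w s * (h s)\<^sup>2) + (LINT s|lborel. w s * (k s)\<^sup>2)) / (n * \<epsilon>\<^sup>2)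
    = 1 - (n * (LINT s|lborel. w s * (h s)\<^sup>2) + n * (LINT s|lborel. w s * (k s)\<^sup>2)) / d"
    using n \<epsilon> by (simp add: d_def power2_eq_square field_simps)
  also have "\<dots> = (LINT x|?L. ?P x - (?P x * (\<Sum>i<n. h (x i))\<^sup>2 + ?P x * (\<Sum>i<n. k (x i))\<^sup>2) / d)"
    using Pi H K P1 by simp
  also have "\<dots> \<le> (LINT x|?L. ?P x * indicator G x)"
  proof (rule integral_mono[OF iR int])
    fix x assume x: "x \<in> space ?L"
    define a b where "a = (\<Sum>i<n. h (x i))" and "b = (\<Sum>i<n. k (x i))"
    have "1 - (a\<^sup>2 + b\<^sup>2) / d \<le> indicator G x"
    proof (cases "x \<in> G")
      case True
      then show ?thesis using d by simp
    next
      case False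
      then have "real n * \<epsilon> \<le> \<bar>a\<bar> \<or> real n * \<epsilon> \<le> \<bar>b\<bar>" using x by (auto simp: G_def a_def b_def)
      then have "d \<le> a\<^sup>2 \<or> d \<le> b\<^sup>2"
        using n \<epsilon> unfolding d_def by (auto simp flip: abs_le_square_iff)
      then have "d \<le> a\<^sup>2 + b\<^sup>2" by (auto intro: add_increasing add_increasing2)
      then show ?thesis using d False by simp
    qed
    then have "?P x * (1 - (a\<^sup>2 + b\<^sup>2) / d) \<le> ?P x * indicator G x" by (intro mult_left_mono P0)
    then show "?P x - (?P x * (\<Sum>i<n. h (x i))\<^sup>2 + ?P x * (\<Sum>i<n. k (x i))\<^sup>2) / d \<le> ?P x * indicator G x"
      by (simp add: a_def b_def algebra_simps add_divide_distrib)
  qed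
  finally show "1 - ((LINT s|lborel. w s * (h s)\<^sup>2) + (LINT s|lborel. w s * (k s)\<^sup>2)) / (n * \<epsilon>\<^sup>2)
    \<le> (LINT x|?L. ?P x * indicator G x)" .
qed

text \<open>The free scale \<open>b\<close> lets a tilted sample be shrunk later without a change of
  variables in the product space.\<close>

definition psum :: "real \<Rightarrow> real \<Rightarrow> nat \<Rightarrow> (nat \<Rightarrow> real) \<Rightarrow> real" where
  "psum r b n x = (\<Sum>i<n. \<bar>x i / b\<bar> powr r)"

lemma psum_measurable [measurable]: "psum r b n \<in> borel_measurable (lebesgue_n n)"
  unfolding psum_def by measurable

context lp_exponents
begin

lemma prod_ew: "(\<Prod>i<n. ew t1 t2 (x i / b)) = exp (t1 * psum q b n x + t2 * psum p b n x)"
  by (simp add: ew_def psum_def sum_distrib_left flip: exp_sum sum.distrib)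

text \<open>The exponential Markov inequality for Lebesgue measure itself: on \<open>A\<close> the
  product weight is at least \<open>exp c\<close>, and its total mass is
  \<open>(b * Z t1 t2) ^ n\<close>. Finiteness of the volume is a by-product.\<close>

lemma emeasure_chernoff:
  assumes t: "admissible t1 t2" and b: "b > 0"
    and A: "A \<in> sets (lebesgue_n n)" "\<And>x. x \<in> A \<Longrightarrow> c \<le> t1 * psum q b n x + t2 * psum p b n x"
  shows "emeasure (lebesgue_n n) A \<le> ennreal ((b * Z t1 t2) ^ n * exp (- c))"
proof -
  let ?L = "lebesgue_n n"
  have one: "(\<integral>\<^sup>+s. ennreal (ew t1 t2 (s / b)) \<partial>lborel) = ennreal (b * Z t1 t2)"
  proof -
    have "ennreal (Z t1 t2) = ennreal (1 / b) * (\<integral>\<^sup>+s. ennreal (ew t1 t2 (s / b)) \<partial>lborel)"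
      using nn_integral_real_affine[where f = "\<lambda>s. ennreal (ew t1 t2 s)" and c = "1 / b" and t = 0]
        b nZ_eq_Z[OF t] by (simp add: nZ_def)
    then have "ennreal b * ennreal (Z t1 t2) = ennreal b * ennreal (1 / b) * (\<integral>\<^sup>+s. ennreal (ew t1 t2 (s / b)) \<partial>lborel)"
      by (simp add: mult.assoc)
    then show ?thesis using b Z_pos[OF t] by (simp flip: ennreal_mult)
  qed
  have "emeasure ?L A = (\<integral>\<^sup>+x. indicator A x \<partial>?L)" using A by simp
  also have "\<dots> \<le> (\<integral>\<^sup>+x. ennreal (exp (- c)) * (\<Prod>i<n. ennreal (ew t1 t2 (x i / b))) \<partial>?L)"
  proof (rule nn_integral_mono)
    fix x
    show "indicator A x \<le> ennreal (exp (- c)) * (\<Prod>i<n. ennreal (ew t1 t2 (x i / b)))"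
    proof (cases "x \<in> A")
      case True
      have "1 \<le> exp (t1 * psum q b n x + t2 * psum p b n x - c)" using A(2)[OF True] by simp
      also have "\<dots> = exp (- c) * (\<Prod>i<n. ew t1 t2 (x i / b))"
        unfolding prod_ew by (simp flip: exp_add)
      finally have "ennreal 1 \<le> ennreal (exp (- c) * (\<Prod>i<n. ew t1 t2 (x i / b)))" by (rule ennreal_leI)
      then show ?thesis using True by (simp add: prod_ennreal ennreal_mult')
    qed simp
  qed
  also have "\<dots> = ennreal (exp (- c)) * ennreal (b * Z t1 t2) ^ n"
  proof (subst nn_integral_cmult)
    show "(\<lambda>x. \<Prod>i<n. ennreal (ew t1 t2 (x i / b))) \<in> borel_measurable ?L"
      by (intro borel_measurable_prod_ennreal measurable_compose[OF measurable_component_lebesgue_n]) auto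
    show "ennreal (exp (- c)) * (\<integral>\<^sup>+x. (\<Prod>i<n. ennreal (ew t1 t2 (x i / b))) \<partial>?L)
      = ennreal (exp (- c)) * ennreal (b * Z t1 t2) ^ n"
      unfolding lebesgue_n_def by (subst lborel_product.product_nn_integral_prod) (auto simp: one)
  qed
  also have "\<dots> = ennreal ((b * Z t1 t2) ^ n * exp (- c))"
    using b Z_pos[OF t] by (simp add: mult.commute ennreal_power flip: ennreal_mult)
  finally show ?thesis .
qed

text \<open>Change of measure: on the typical set the normalized product weight is at most
  \<open>1 / D\<close>, so the volume is at least \<open>D\<close> times the tilted probability.
  \<open>C\<close> is a sum of two variances, which do not depend on \<open>n\<close>,
  \<open>b\<close> or \<open>\<epsilon>\<close>.\<close>

lemma emeasure_tilt_lower: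
  assumes t: "admissible t1 t2"
  obtains C where "\<And>n b \<epsilon>. \<lbrakk>n > 0; b > 0; \<epsilon> > 0\<rbrakk> \<Longrightarrow>
    ennreal ((1 - C / (n * \<epsilon>\<^sup>2)) * ((b * Z t1 t2) ^ n *
        exp (- (n * (t1 * mean q t1 t2 + t2 * mean p t1 t2 + \<epsilon> * (\<bar>t1\<bar> + \<bar>t2\<bar>))))))
    \<le> emeasure (lebesgue_n n) {x \<in> space (lebesgue_n n).
        \<bar>psum q b n x - n * mean q t1 t2\<bar> < n * \<epsilon> \<and> \<bar>psum p b n x - n * mean p t1 t2\<bar> < n * \<epsilon>}"
proof
  define mq mp where "mq = mean q t1 t2" and "mp = mean p t1 t2"
  define Zt where "Zt = Z t1 t2"
  have Zt: "Zt > 0" using Z_pos[OF t] by (simp add: Zt_def)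
  define h where "h r s = \<bar>s\<bar> powr r - mean r t1 t2" for r s
  define C where "C = (LINT s|lborel. ew t1 t2 s * (h q s)\<^sup>2) / Zt + (LINT s|lborel. ew t1 t2 s * (h p s)\<^sup>2) / Zt"
  fix n :: nat and b \<epsilon> :: real assume n: "n > 0" and b: "b > 0" and \<epsilon>: "\<epsilon> > 0"
  let ?L = "lebesgue_n n"
  define w where "w s = ew t1 t2 (s / b) / (b * Zt)" for s
  have scale: "integrable lborel (\<lambda>s. w s * f (s / b))"
      "(LINT s|lborel. w s * f (s / b)) = (LINT s|lborel. ew t1 t2 s * f s) / Zt"
    if "integrable lborel (\<lambda>s. ew t1 t2 s * f s)" for f :: "real \<Rightarrow> real"
  proof -
    have e: "w s * f (s / b) = ew t1 t2 (0 + 1 / b * s) * f (0 + 1 / b * s) / (b * Zt)" for s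
      by (simp add: w_def)
    show "integrable lborel (\<lambda>s. w s * f (s / b))"
      unfolding e using lborel_integrable_real_affine[OF that, of "1 / b" 0] b
      by (intro integrable_divide_zero) auto
    show "(LINT s|lborel. w s * f (s / b)) = (LINT s|lborel. ew t1 t2 s * f s) / Zt"
      unfolding e using lborel_integral_real_affine[of "1 / b" "\<lambda>s. ew t1 t2 s * f s" 0] b Zt
      by (simp add: field_simps)
  qed
  have ih: "integrable lborel (\<lambda>s. ew t1 t2 s * h r s)" if "r \<ge> 0" for r
    using integrable_powr_ew[OF t that] integrable_ew[OF t] by (simp add: h_def algebra_simps)
  have ih2: "integrable lborel (\<lambda>s. ew t1 t2 s * (h r s)\<^sup>2)" if "r \<ge> 0" for r
  proof -
    have "ew t1 t2 s * (h r s)\<^sup>2 = \<bar>s\<bar> powr (2 * r) * ew t1 t2 s - 2 * mean r t1 t2 * (\<bar>s\<bar> powr r * ew t1 t2 s)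
      + (mean r t1 t2)\<^sup>2 * ew t1 t2 s" for s
    proof -
      have "\<bar>s\<bar> powr (2 * r) = (\<bar>s\<bar> powr r)\<^sup>2" by (simp add: power2_eq_square flip: powr_add)
      then show ?thesis by (simp add: h_def power2_eq_square algebra_simps)
    qed
    then show ?thesis
      using integrable_powr_ew[OF t that] integrable_powr_ew[OF t, of "2 * r"] integrable_ew[OF t] that by simp
  qed
  have h0: "(LINT s|lborel. ew t1 t2 s * h r s) = 0" if "r \<ge> 0" for r
  proof -
    have "(LINT s|lborel. ew t1 t2 s * h r s) = mom r t1 t2 - mean r t1 t2 * Zt"
      using integrable_powr_ew[OF t that] integrable_ew[OF t]
      by (simp add: h_def right_diff_distrib mom_def Zt_def Z_def mult.commute)
    then show ?thesis using Zt by (simp add: mean_def Zt_def)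
  qed
  have [measurable]: "(\<lambda>s. h r (s / b)) \<in> borel_measurable borel" for r by (simp add: h_def)
  have q0: "q \<ge> 0" and p0: "p \<ge> 0" using pq_pos by auto
  define G where "G = {x \<in> space ?L. \<bar>\<Sum>i<n. h q (x i / b)\<bar> < n * \<epsilon> \<and> \<bar>\<Sum>i<n. h p (x i / b)\<bar> < n * \<epsilon>}"
  have Gm [measurable]: "G \<in> sets ?L" unfolding G_def by measurable
  have hs: "(\<Sum>i<n. h r (x i / b)) = psum r b n x - n * mean r t1 t2" for r x
    by (simp add: h_def psum_def sum_subtractf)
  define P where "P x = (\<Prod>i<n. w (x i))" for x :: "nat \<Rightarrow> real"
  have cheb: "1 - C / (n * \<epsilon>\<^sup>2) \<le> (LINT x|?L. P x * indicator G x)" "integrable ?L (\<lambda>x. P x * indicator G x)"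
  proof -
    have w1: "integrable lborel w" "(LINT s|lborel. w s) = 1"
      using scale[of "\<lambda>_. 1"] integrable_ew[OF t] Zt by (auto simp: Zt_def Z_def)
    have w0: "w s \<ge> 0" for s using b Zt by (simp add: w_def)
    note c = chebyshev_product[where w = w and h = "\<lambda>s. h q (s / b)" and k = "\<lambda>s. h p (s / b)"
      and n = n and \<epsilon> = \<epsilon>, folded G_def]
    note sq = scale[OF ih[OF q0]] scale[OF ih2[OF q0]]
    note sp = scale[OF ih[OF p0]] scale[OF ih2[OF p0]]
    show "1 - C / (n * \<epsilon>\<^sup>2) \<le> (LINT x|?L. P x * indicator G x)"
      using c(1) w1 w0 sq sp h0 q0 p0 n \<epsilon> by (simp add: C_def P_def)
    show "integrable ?L (\<lambda>x. P x * indicator G x)"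
      using c(2) w1 w0 sq sp h0 q0 p0 n \<epsilon> by (simp add: P_def)
  qed
  define D where "D = (b * Zt) ^ n * exp (- (n * (t1 * mq + t2 * mp + \<epsilon> * (\<bar>t1\<bar> + \<bar>t2\<bar>))))"
  have D: "D > 0" using b Zt by (simp add: D_def)
  have P0: "P x \<ge> 0" for x unfolding P_def w_def using b Zt by (intro prod_nonneg) auto
  have PD: "P x \<le> 1 / D" if "x \<in> G" for x
  proof -
    have "t1 * (psum q b n x - n * mq) \<le> \<bar>t1\<bar> * (n * \<epsilon>)"
    proof -
      have "t1 * (psum q b n x - n * mq) \<le> \<bar>t1\<bar> * \<bar>psum q b n x - n * mq\<bar>"
        by (metis abs_ge_self abs_mult)
      also have "\<dots> \<le> \<bar>t1\<bar> * (n * \<epsilon>)"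
        using that by (intro mult_left_mono) (auto simp: G_def hs mq_def)
      finally show ?thesis .
    qed
    moreover have "t2 * (psum p b n x - n * mp) \<le> \<bar>t2\<bar> * (n * \<epsilon>)"
    proof -
      have "t2 * (psum p b n x - n * mp) \<le> \<bar>t2\<bar> * \<bar>psum p b n x - n * mp\<bar>"
        by (metis abs_ge_self abs_mult)
      also have "\<dots> \<le> \<bar>t2\<bar> * (n * \<epsilon>)"
        using that by (intro mult_left_mono) (auto simp: G_def hs mp_def)
      finally show ?thesis .
    qed
    ultimately have "t1 * psum q b n x + t2 * psum p b n x \<le> n * (t1 * mq + t2 * mp + \<epsilon> * (\<bar>t1\<bar> + \<bar>t2\<bar>))"
      by (simp add: algebra_simps)
    then have "exp (t1 * psum q b n x + t2 * psum p b n x) / (b * Zt) ^ n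
      \<le> exp (n * (t1 * mq + t2 * mp + \<epsilon> * (\<bar>t1\<bar> + \<bar>t2\<bar>))) / (b * Zt) ^ n"
      using b Zt by (intro divide_right_mono) auto
    moreover have "P x = exp (t1 * psum q b n x + t2 * psum p b n x) / (b * Zt) ^ n"
      unfolding P_def w_def by (simp add: prod_dividef prod_ew)
    moreover have "1 / D = exp (n * (t1 * mq + t2 * mp + \<epsilon> * (\<bar>t1\<bar> + \<bar>t2\<bar>))) / (b * Zt) ^ n"
      by (simp add: D_def exp_minus divide_inverse mult_ac)
    ultimately show ?thesis by simp
  qed
  \<comment> \<open>For small \<open>n\<close> the argument on the left may be negative;
    \<open>ennreal\<close> then turns it into 0.\<close>
  have "ennreal (1 - C / (n * \<epsilon>\<^sup>2)) \<le> ennreal (LINT x|?L. P x * indicator G x)"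
    by (intro ennreal_leI cheb)
  also have "\<dots> = (\<integral>\<^sup>+x. ennreal (P x * indicator G x) \<partial>?L)"
    using cheb(2) P0 by (intro nn_integral_eq_integral[symmetric]) auto
  also have "\<dots> \<le> (\<integral>\<^sup>+x. ennreal (1 / D) * indicator G x \<partial>?L)"
    using PD by (intro nn_integral_mono) (auto simp: indicator_def intro!: ennreal_leI)
  also have "\<dots> = ennreal (1 / D) * emeasure ?L G" by (simp add: nn_integral_cmult_indicator)
  finally have "ennreal D * ennreal (1 - C / (n * \<epsilon>\<^sup>2)) \<le> ennreal D * (ennreal (1 / D) * emeasure ?L G)"
    by (intro mult_left_mono) auto
  also have "\<dots> = emeasure ?L G"
    using D by (simp add: mult.assoc[symmetric] ennreal_mult[symmetric])
  also have "ennreal D * ennreal (1 - C / (n * \<epsilon>\<^sup>2)) = ennreal ((1 - C / (n * \<epsilon>\<^sup>2)) * D)"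
    using D by (simp add: mult.commute ennreal_mult')
  finally show "ennreal ((1 - C / (n * \<epsilon>\<^sup>2)) * ((b * Z t1 t2) ^ n *
        exp (- (n * (t1 * mean q t1 t2 + t2 * mean p t1 t2 + \<epsilon> * (\<bar>t1\<bar> + \<bar>t2\<bar>))))))
    \<le> emeasure (lebesgue_n n) {x \<in> space (lebesgue_n n).
        \<bar>psum q b n x - n * mean q t1 t2\<bar> < n * \<epsilon> \<and> \<bar>psum p b n x - n * mean p t1 t2\<bar> < n * \<epsilon>}"
    by (simp add: D_def Zt_def mq_def mp_def G_def hs)
qed

section \<open>The large deviation principle\<close>

lemma Irate_neg: "z < 0 \<Longrightarrow> Irate p q z = \<infinity>"
  by (simp add: Irate_def)

lemma val_std: "val 0 (- (1 / p)) x = 0"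
  by (simp add: val_def ball_exponent_def norm_const_def)

lemma Irate_nonneg: "Irate p q z \<ge> 0"
  using val_le_Irate[of z 0 "- (1 / p)"] admissible_std Irate_neg[of z]
  by (cases "z < 0") (auto simp: val_std simp flip: zero_ereal_def)

text \<open>Near \<open>z0\<close> the rate lies above one continuous function built from
  \<open>val t1 t2\<close>, which exceeds \<open>\<alpha>\<close> at \<open>z0\<close>. This gives
  both lower semicontinuity and closed level sets.\<close>

lemma Irate_eventually_gt:
  assumes "ereal \<alpha> < Irate p q z0"
  shows "\<forall>\<^sub>F z in nhds z0. ereal \<alpha> < Irate p q z"
proof (cases "z0 < 0")
  case True
  then have "\<forall>\<^sub>F z in nhds z0. z < 0" by (intro order_tendstoD(2)[OF filterlim_ident])
  then show ?thesis by eventually_elim (simp add: Irate_neg)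
next
  case False
  obtain \<alpha>' where \<alpha>': "\<alpha> < \<alpha>'" "ereal \<alpha>' < Irate p q z0"
    using ereal_dense2[OF assms] by auto
  obtain t1 t2 where t: "admissible t1 t2" "\<alpha>' \<le> val t1 t2 (z0 powr q)"
  proof (cases "z0 \<le> zs")
    case True
    then show ?thesis using multiplier_left[OF \<alpha>'(2)] False that by (metis not_less)
  next
    case False
    then show ?thesis using multiplier_right[OF \<alpha>'(2)] that by (metis less_imp_le not_less)
  qed
  \<comment> \<open>The absolute value makes the minorant continuous on the whole line; negative
    points close to \<open>z0 = 0\<close> have infinite rate anyway.\<close>
  have "continuous_on UNIV (\<lambda>z. val t1 t2 (\<bar>z\<bar> powr q))"
    unfolding val_def using pq_pos by (intro continuous_intros continuous_on_powr') auto
  then have "isCont (\<lambda>z. val t1 t2 (\<bar>z\<bar> powr q)) z0"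
    by (simp add: continuous_on_eq_continuous_at)
  then have "((\<lambda>z. val t1 t2 (\<bar>z\<bar> powr q)) \<longlongrightarrow> val t1 t2 (\<bar>z0\<bar> powr q)) (nhds z0)"
    unfolding continuous_at
    by (rule tendsto_at_iff_tendsto_nhds[of "\<lambda>z. val t1 t2 (\<bar>z\<bar> powr q)", THEN iffD1])
  then have "\<forall>\<^sub>F z in nhds z0. \<alpha> < val t1 t2 (\<bar>z\<bar> powr q)"
    by (rule order_tendstoD) (use False t \<alpha>' in simp)
  then show ?thesis
  proof eventually_elim
    case (elim z)
    show ?case
    proof (cases "z < 0")
      case False
      then have "ereal \<alpha> < ereal (val t1 t2 (z powr q))" using elim by simp
      also have "\<dots> \<le> Irate p q z" using False t by (intro val_le_Irate) auto
      finally show ?thesis .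
    qed (simp add: Irate_neg)
  qed
qed

lemma good_Irate: "good_rate_function (Irate p q)"
proof -
  have "lsc (Irate p q)"
    unfolding lsc_def le_Liminf_iff
  proof safe
    fix x y assume "y < Irate p q x"
    then obtain \<alpha> where a: "y < ereal \<alpha>" "ereal \<alpha> < Irate p q x" using ereal_dense2 by blast
    from Irate_eventually_gt[OF a(2)] have "\<forall>\<^sub>F z in at x. ereal \<alpha> < Irate p q z"
      unfolding eventually_at_filter by (rule eventually_mono) simp
    then show "\<forall>\<^sub>F z in at x. y < Irate p q z" by eventually_elim (use a in auto)
  qed
  moreover have "compact {x. Irate p q x \<le> ereal \<alpha>}" for \<alpha>
  proof -
    have "open {x. ereal \<alpha> < Irate p q x}"
    proof (subst open_subopen, safe)
      fix x assume "ereal \<alpha> < Irate p q x"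
      from Irate_eventually_gt[OF this]
      show "\<exists>T. open T \<and> x \<in> T \<and> T \<subseteq> {x. ereal \<alpha> < Irate p q x}"
        unfolding eventually_nhds by blast
    qed
    moreover have "{x. Irate p q x \<le> ereal \<alpha>} = - {x. ereal \<alpha> < Irate p q x}" by auto
    ultimately have "closed {x. Irate p q x \<le> ereal \<alpha>}" by (simp add: closed_def)
    moreover have "{x. Irate p q x \<le> ereal \<alpha>} \<subseteq> {0..1}"
    proof safe
      fix x assume x: "Irate p q x \<le> ereal \<alpha>"
      then have "\<not> x < 0" "\<not> x \<ge> 1" using Irate_neg[of x] Irate_ge_1[of x] by auto
      then show "x \<in> {0..1}" by auto
    qed
    ultimately show ?thesis
      using bounded_subset[OF bounded_closed_interval] by (auto simp: compact_eq_bounded_closed)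
  qed
  ultimately show ?thesis
    by (simp add: good_rate_function_def rate_function_def Irate_nonneg)
qed

section \<open>Volumes of slices of the ball\<close>

definition scaled_norm :: "nat \<Rightarrow> (nat \<Rightarrow> real) \<Rightarrow> real" where
  "scaled_norm n x = real n powr (1/p - 1/q) * lp_norm q n x"

text \<open>Left unnormalized: all volume bounds carry the factor \<open>bn n ^ n\<close>, which
  cancels in the quotient of \<open>law_eq\<close>.\<close>

definition vol :: "nat \<Rightarrow> real set \<Rightarrow> real" where
  "vol n A = measure (lebesgue_n n) {x \<in> lp_ball p n. scaled_norm n x \<in> A}"

definition bn :: "nat \<Rightarrow> real" where "bn n = real n powr (- 1 / p)"

lemma bn_pos: "n > 0 \<Longrightarrow> bn n > 0"
  by (simp add: bn_def)

lemma psum_eq: "b > 0 \<Longrightarrow> psum r b n x = (\<Sum>i<n. \<bar>x i\<bar> powr r) / b powr r"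
  by (simp add: psum_def abs_divide powr_divide sum_divide_distrib)

lemma psum_bn:
  assumes "n > 0"
  shows "psum r (bn n) n x = (\<Sum>i<n. \<bar>x i\<bar> powr r) * real n powr (r / p)"
proof -
  have "bn n powr r = real n powr - (r / p)" by (simp add: bn_def powr_powr)
  then show ?thesis by (simp add: psum_eq[OF bn_pos[OF assms]] powr_minus divide_inverse)
qed

lemma lp_ball_iff:
  assumes "n > 0"
  shows "x \<in> lp_ball p n \<longleftrightarrow> x \<in> space (lebesgue_n n) \<and> psum p (bn n) n x \<le> n"
proof -
  define S where "S = (\<Sum>i<n. \<bar>x i\<bar> powr p)"
  have S: "S \<ge> 0" by (auto simp: S_def intro: sum_nonneg)
  have "S powr (1 / p) \<le> 1 \<longleftrightarrow> S \<le> 1"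
  proof
    assume "S powr (1 / p) \<le> 1"
    then have "(S powr (1 / p)) powr p \<le> 1 powr p" using pq_pos by (intro powr_mono2) auto
    then show "S \<le> 1" using S pq_pos by (simp add: powr_powr)
  next
    assume "S \<le> 1"
    then have "S powr (1 / p) \<le> 1 powr (1 / p)" using S pq_pos by (intro powr_mono2) auto
    then show "S powr (1 / p) \<le> 1" by simp
  qed
  moreover have "psum p (bn n) n x = S * n"
    using assms pq_pos by (simp add: psum_bn S_def)
  moreover have "S * n \<le> n \<longleftrightarrow> S \<le> 1" using assms by simp
  ultimately show ?thesis by (simp add: lp_ball_def lp_norm_def S_def)
qed

lemma scaled_norm_eq:
  assumes "n > 0"
  shows "scaled_norm n x = (psum q (bn n) n x / n) powr (1 / q)"
proof -
  define S where "S = (\<Sum>i<n. \<bar>x i\<bar> powr q)"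
  have S: "S \<ge> 0" by (auto simp: S_def intro: sum_nonneg)
  have "psum q (bn n) n x / n = S * real n powr (q / p - 1)"
    using assms by (simp add: psum_bn S_def powr_diff)
  moreover have "(S * real n powr (q / p - 1)) powr (1 / q) = S powr (1 / q) * real n powr (1 / p - 1 / q)"
    using S assms pq_pos by (simp add: powr_mult powr_powr field_simps)
  ultimately show ?thesis by (simp add: scaled_norm_def lp_norm_def S_def mult.commute)
qed

lemma scaled_norm_nonneg: "scaled_norm n x \<ge> 0"
  by (simp add: scaled_norm_def lp_norm_def)

lemma scaled_norm_powr:
  assumes "n > 0"
  shows "scaled_norm n x powr q = psum q (bn n) n x / n"
proof -
  have "psum q (bn n) n x \<ge> 0" by (auto simp: psum_def intro: sum_nonneg)
  then show ?thesis using pq_pos by (simp add: scaled_norm_eq[OF assms] powr_powr)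
qed

lemma lp_ball_sets [measurable]: "lp_ball p n \<in> sets (lebesgue_n n)"
  unfolding lp_ball_def lp_norm_def by measurable

lemma scaled_norm_measurable [measurable]: "scaled_norm n \<in> borel_measurable (lebesgue_n n)"
  unfolding scaled_norm_def lp_norm_def by measurable

lemma slice_sets [measurable]:
  assumes [measurable]: "A \<in> sets borel"
  shows "{x \<in> lp_ball p n. scaled_norm n x \<in> A} \<in> sets (lebesgue_n n)"
proof -
  have "{x \<in> lp_ball p n. scaled_norm n x \<in> A}
    = {x \<in> space (lebesgue_n n). x \<in> lp_ball p n \<and> scaled_norm n x \<in> A}"
    by (auto simp: lp_ball_def)
  also have "\<dots> \<in> sets (lebesgue_n n)" by measurable
  finally show ?thesis .
qed

text \<open>By \<open>le\<close>, \<open>t1 * v powr q\<close> is never smaller on the slice than at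
  \<open>z\<close>, and \<open>t2 \<le> 0\<close> turns membership in the ball into
  \<open>t2 * n \<le> t2 * psum p (bn n) n x\<close>; the sum of both is the hypothesis of
  \<open>emeasure_chernoff\<close>.\<close>

lemma emeasure_slice_le:
  assumes n: "n > 0" and t: "admissible t1 t2" and A: "A \<in> sets borel"
    and le: "\<And>v. v \<in> A \<Longrightarrow> 0 \<le> v \<Longrightarrow> t1 * z powr q \<le> t1 * v powr q"
  shows "emeasure (lebesgue_n n) {x \<in> lp_ball p n. scaled_norm n x \<in> A}
    \<le> ennreal (bn n ^ n * exp (- (n * (val t1 t2 (z powr q) - ball_exponent))))"
proof -
  have "emeasure (lebesgue_n n) {x \<in> lp_ball p n. scaled_norm n x \<in> A}
    \<le> ennreal ((bn n * Z t1 t2) ^ n * exp (- (n * (t1 * z powr q + t2))))"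
  proof (rule emeasure_chernoff[OF t bn_pos[OF n] slice_sets[OF A]])
    fix x assume x: "x \<in> {x \<in> lp_ball p n. scaled_norm n x \<in> A}"
    have "t1 * z powr q \<le> t1 * (psum q (bn n) n x / n)"
      using le[of "scaled_norm n x"] x scaled_norm_nonneg by (simp add: scaled_norm_powr[OF n])
    then have "n * (t1 * z powr q) \<le> n * (t1 * (psum q (bn n) n x / n))"
      by (rule mult_left_mono) simp
    then have "n * (t1 * z powr q) \<le> t1 * psum q (bn n) n x" using n by simp
    moreover have "t2 * n \<le> t2 * psum p (bn n) n x"
      using x lp_ball_iff[OF n] admissible_le_0[OF t] by (intro mult_left_mono_neg) auto
    ultimately show "real n * (t1 * z powr q + t2) \<le> t1 * psum q (bn n) n x + t2 * psum p (bn n) n x"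
      by (simp add: algebra_simps)
  qed
  also have "(bn n * Z t1 t2) ^ n * exp (- (n * (t1 * z powr q + t2)))
      = bn n ^ n * exp (- (n * (val t1 t2 (z powr q) - ball_exponent)))"
  proof -
    have "Z t1 t2 ^ n = exp (n * ln (Z t1 t2))"
      using Z_pos[OF t] by (simp add: exp_of_nat_mult)
    then show ?thesis
      by (simp add: power_mult_distrib val_def algebra_simps flip: exp_add)
  qed
  finally show ?thesis .
qed

lemma emeasure_slice_finite:
  assumes "n > 0" "A \<in> sets borel"
  shows "emeasure (lebesgue_n n) {x \<in> lp_ball p n. scaled_norm n x \<in> A} < \<infinity>"
  using emeasure_slice_le[OF assms(1) admissible_std assms(2), of zs]
  by (simp add: le_less_trans[OF _ ennreal_less_top])

lemma vol_le:
  assumes "n > 0" and "admissible t1 t2" and "A \<in> sets borel"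
    and "\<And>v. v \<in> A \<Longrightarrow> 0 \<le> v \<Longrightarrow> t1 * z powr q \<le> t1 * v powr q"
  shows "vol n A \<le> bn n ^ n * exp (- (n * (val t1 t2 (z powr q) - ball_exponent)))"
  unfolding vol_def measure_def
  using emeasure_slice_le[OF assms] bn_pos[OF assms(1)] by (intro enn2real_leI) auto

lemma vol_mono:
  assumes "n > 0" "A \<subseteq> B" "A \<in> sets borel" "B \<in> sets borel"
  shows "vol n A \<le> vol n B"
  unfolding vol_def using assms slice_sets emeasure_slice_finite[of n B]
  by (intro measure_mono_fmeasurable) (auto intro!: fmeasurableI)

lemma vol_Un_le:
  assumes "n > 0" "A \<in> sets borel" "B \<in> sets borel"
  shows "vol n (A \<union> B) \<le> vol n A + vol n B"
proof -
  have "{x \<in> lp_ball p n. scaled_norm n x \<in> A \<union> B}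
    = {x \<in> lp_ball p n. scaled_norm n x \<in> A} \<union> {x \<in> lp_ball p n. scaled_norm n x \<in> B}" by auto
  then show ?thesis
    unfolding vol_def using assms slice_sets by (simp add: measure_Un_le)
qed

lemma vol_nonneg: "vol n A \<ge> 0"
  by (simp add: vol_def)

text \<open>The tilted sample need not lie in the ball when the constraint is active; the dilation by
  \<open>a = (1 + \<epsilon>) powr (-1/p)\<close> moves it there at a cost that vanishes with \<open>\<epsilon>\<close>.\<close>

lemma vol_lower:
  assumes t: "optimal t1 t2 (z powr q)" and z: "0 < z" and G: "open G" "z \<in> G" and \<eta>: "\<eta> > 0"
  shows "\<forall>\<^sub>F n in sequentially. bn n ^ n * exp (- (n * (val t1 t2 (z powr q) - ball_exponent + \<eta>))) \<le> vol n G"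
proof -
  define x where "x = z powr q"
  have x: "x > 0" using z by (simp add: x_def)
  have xz: "x powr (1 / q) = z" using z pq_pos by (simp add: x_def powr_powr)
  have dt: "admissible t1 t2" and mq: "mean q t1 t2 = x" and mp: "mean p t1 t2 \<le> 1"
    using t by (auto simp: optimal_def x_def)
  have sl: "t2 * mean p t1 t2 = t2"
    using t unfolding optimal_def right_diff_distrib by linarith
  obtain \<delta> where \<delta>: "\<delta> > 0" "\<And>y. \<bar>y - z\<bar> < \<delta> \<Longrightarrow> y \<in> G"
    using G by (auto simp: open_dist dist_real_def)
  have "((\<lambda>e. (1 + e) powr (- 1 / p) * (x - e) powr (1 / q)) \<longlongrightarrow> (1 + 0) powr (- 1 / p) * (x - 0) powr (1 / q)) (at_right 0)"
    using x by (intro tendsto_intros) auto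
  then have e1: "\<forall>\<^sub>F e in at_right 0. z - \<delta> < (1 + e) powr (- 1 / p) * (x - e) powr (1 / q)"
    by (rule order_tendstoD) (use \<delta> xz in simp)
  have "((\<lambda>e. (x + e) powr (1 / q)) \<longlongrightarrow> (x + 0) powr (1 / q)) (at_right 0)"
    using x by (intro tendsto_intros) auto
  then have e2: "\<forall>\<^sub>F e in at_right 0. (x + e) powr (1 / q) < z + \<delta>"
    by (rule order_tendstoD) (use \<delta> xz in simp)
  have "((\<lambda>e. ln (1 + e) / p + e * (\<bar>t1\<bar> + \<bar>t2\<bar>)) \<longlongrightarrow> ln (1 + 0) / p + 0 * (\<bar>t1\<bar> + \<bar>t2\<bar>)) (at_right 0)"
    using pq_pos by (intro tendsto_intros) auto
  then have e3: "\<forall>\<^sub>F e in at_right 0. ln (1 + e) / p + e * (\<bar>t1\<bar> + \<bar>t2\<bar>) < \<eta> / 2"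
    by (rule order_tendstoD) (use \<eta> in simp)
  have e4: "\<forall>\<^sub>F e in at_right 0. e < x" using x by (intro order_tendstoD(2)[OF tendsto_ident_at])
  have e5: "\<forall>\<^sub>F e::real in at_right 0. 0 < e" by (simp add: eventually_at_filter)
  \<comment> \<open>Two of the conditions keep the norm within \<open>\<delta>\<close> of
    \<open>z\<close>; the last one bounds the cost of tilting and dilating by half of
    \<open>\<eta>\<close>.\<close>
  obtain \<epsilon> where \<epsilon>: "0 < \<epsilon>" "\<epsilon> < x" "z - \<delta> < (1 + \<epsilon>) powr (- 1 / p) * (x - \<epsilon>) powr (1 / q)"
      "(x + \<epsilon>) powr (1 / q) < z + \<delta>" "ln (1 + \<epsilon>) / p + \<epsilon> * (\<bar>t1\<bar> + \<bar>t2\<bar>) < \<eta> / 2"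
    using eventually_happens[OF eventually_conj[OF e1 eventually_conj[OF e2 eventually_conj[OF e3 eventually_conj[OF e4 e5]]]]]
    by (auto simp: trivial_limit_at_right_real)
  define a where "a = (1 + \<epsilon>) powr (- 1 / p)"
  have a: "0 < a" using \<epsilon>(1) by (simp add: a_def)
  have lna: "ln a = - ln (1 + \<epsilon>) / p" using \<epsilon>(1) by (simp add: a_def ln_powr)
  have "a powr p = (1 + \<epsilon>) powr (-1)" using pq_pos by (simp add: a_def powr_powr)
  then have ap: "a powr p = 1 / (1 + \<epsilon>)" using \<epsilon>(1) by (simp only: powr_minus_divide) simp
  have "a \<le> (1 + \<epsilon>) powr 0" unfolding a_def using \<epsilon>(1) pq_pos by (intro powr_mono) auto
  then have a1: "a \<le> 1" using \<epsilon>(1) by simp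
  obtain C where C: "\<And>n b e. \<lbrakk>n > 0; b > 0; e > 0\<rbrakk> \<Longrightarrow>
    ennreal ((1 - C / (n * e\<^sup>2)) * ((b * Z t1 t2) ^ n *
        exp (- (n * (t1 * mean q t1 t2 + t2 * mean p t1 t2 + e * (\<bar>t1\<bar> + \<bar>t2\<bar>))))))
    \<le> emeasure (lebesgue_n n) {x \<in> space (lebesgue_n n).
        \<bar>psum q b n x - n * mean q t1 t2\<bar> < n * e \<and> \<bar>psum p b n x - n * mean p t1 t2\<bar> < n * e}"
  proof (rule emeasure_tilt_lower[OF dt], goal_cases)
    case (1 C)
    show ?case by (rule 1(1)) (rule 1(2))
  qed
  \<comment> \<open>The other half of \<open>\<eta>\<close> pays for the Chebyshev factor, which
    eventually exceeds \<open>exp (- (n * (\<eta> / 2)))\<close>.\<close>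
  have "(\<lambda>n. 1 - C / (real n * \<epsilon>\<^sup>2) - exp (- (real n * (\<eta> / 2)))) \<longlonglongrightarrow> 1"
    using \<epsilon>(1) \<eta> by real_asymp
  then have "\<forall>\<^sub>F n in sequentially. 0 < 1 - C / (real n * \<epsilon>\<^sup>2) - exp (- (real n * (\<eta> / 2)))"
    by (rule order_tendstoD) simp
  then show ?thesis using eventually_gt_at_top[of 0]
  proof eventually_elim
    case (elim n)
    then have n: "n > 0" by simp
    define Q where "Q = {x' \<in> space (lebesgue_n n).
        \<bar>psum q (a * bn n) n x' - n * x\<bar> < n * \<epsilon> \<and> \<bar>psum p (a * bn n) n x' - n * mean p t1 t2\<bar> < n * \<epsilon>}"
    have sub: "Q \<subseteq> {x \<in> lp_ball p n. scaled_norm n x \<in> G}"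
    proof
      fix y assume y: "y \<in> Q"
      have sc: "psum r (a * bn n) n y = psum r (bn n) n y / a powr r" for r
        using a bn_pos[OF n] by (simp add: psum_eq powr_mult)
      have "psum p (a * bn n) n y \<le> n * (1 + \<epsilon>)"
      proof -
        have "real n * mean p t1 t2 \<le> real n * 1" using mp by (intro mult_left_mono) auto
        then show ?thesis using y by (simp add: Q_def algebra_simps abs_less_iff)
      qed
      then have ball: "psum p (bn n) n y \<le> n"
        using \<epsilon>(1) by (simp add: sc ap)
      define u where "u = psum q (a * bn n) n y / n"
      have u: "x - \<epsilon> < u" "u < x + \<epsilon>"
        using y n by (auto simp: Q_def u_def field_simps abs_less_iff)
      have "scaled_norm n y = a * u powr (1 / q)"
      proof -
        have "psum q (bn n) n y / n = a powr q * u" using a by (simp add: u_def sc)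
        then show ?thesis using a u \<epsilon> pq_pos by (simp add: scaled_norm_eq[OF n] powr_mult powr_powr)
      qed
      moreover have "a * (x - \<epsilon>) powr (1 / q) \<le> a * u powr (1 / q)"
        using a u \<epsilon> pq_pos by (intro mult_left_mono powr_mono2) auto
      moreover have "a * u powr (1 / q) \<le> 1 * (x + \<epsilon>) powr (1 / q)"
        using a a1 u \<epsilon> pq_pos by (intro mult_mono powr_mono2) auto
      ultimately have "\<bar>scaled_norm n y - z\<bar> < \<delta>" using \<epsilon>(4) \<epsilon>(3)[folded a_def] by linarith
      then show "y \<in> {x \<in> lp_ball p n. scaled_norm n x \<in> G}"
        using \<delta> ball y by (simp add: lp_ball_iff[OF n] Q_def)
    qed
    have Gb: "G \<in> sets borel" using G by simp
    define R where "R = (a * bn n * Z t1 t2) ^ n * exp (- (n * (t1 * x + t2 + \<epsilon> * (\<bar>t1\<bar> + \<bar>t2\<bar>))))"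
    have bpos: "a * bn n > 0" using a bn_pos[OF n] by simp
    have "ennreal ((1 - C / (n * \<epsilon>\<^sup>2)) * R) \<le> emeasure (lebesgue_n n) Q"
      using C[OF n bpos \<epsilon>(1)] unfolding R_def Q_def mq sl .
    also have "\<dots> \<le> emeasure (lebesgue_n n) {x \<in> lp_ball p n. scaled_norm n x \<in> G}"
      by (intro emeasure_mono sub slice_sets Gb)
    also have "\<dots> = ennreal (vol n G)"
      unfolding vol_def using emeasure_slice_finite[OF n Gb] by (simp add: emeasure_eq_ennreal_measure)
    finally have *: "(1 - C / (n * \<epsilon>\<^sup>2)) * R \<le> vol n G" using vol_nonneg by (simp add: ennreal_le_iff)
    have Rpos: "R > 0" using a bn_pos[OF n] Z_pos[OF dt] by (simp add: R_def)
    have "exp (- (n * (\<eta> / 2))) * R \<le> (1 - C / (n * \<epsilon>\<^sup>2)) * R"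
      using elim Rpos by (intro mult_right_mono) auto
    with * have *: "exp (- (n * (\<eta> / 2))) * R \<le> vol n G" by linarith
    have "R = bn n ^ n * exp (n * (ln a + ln (Z t1 t2) - (t1 * x + t2 + \<epsilon> * (\<bar>t1\<bar> + \<bar>t2\<bar>))))"
    proof -
      have "a ^ n = exp (n * ln a)" "Z t1 t2 ^ n = exp (n * ln (Z t1 t2))"
        using a Z_pos[OF dt] by (auto simp: exp_of_nat_mult)
      then show ?thesis by (simp add: R_def power_mult_distrib algebra_simps flip: exp_add)
    qed
    then have "exp (- (n * (\<eta> / 2))) * R = bn n ^ n *
       exp (- (n * (t1 * x + t2 - ln (Z t1 t2) + (ln (1 + \<epsilon>) / p + \<epsilon> * (\<bar>t1\<bar> + \<bar>t2\<bar>)) + \<eta> / 2)))"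
      by (simp add: lna algebra_simps flip: exp_add)
    moreover have "bn n ^ n * exp (- (n * (val t1 t2 x - ball_exponent + \<eta>))) \<le> bn n ^ n *
       exp (- (n * (t1 * x + t2 - ln (Z t1 t2) + (ln (1 + \<epsilon>) / p + \<epsilon> * (\<bar>t1\<bar> + \<bar>t2\<bar>)) + \<eta> / 2)))"
    proof -
      have "t1 * x + t2 - ln (Z t1 t2) + (ln (1 + \<epsilon>) / p + \<epsilon> * (\<bar>t1\<bar> + \<bar>t2\<bar>)) + \<eta> / 2
        \<le> val t1 t2 x - ball_exponent + \<eta>"
        unfolding val_def using \<epsilon>(5) by linarith
      then have "real n * (t1 * x + t2 - ln (Z t1 t2) + (ln (1 + \<epsilon>) / p + \<epsilon> * (\<bar>t1\<bar> + \<bar>t2\<bar>)) + \<eta> / 2)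
        \<le> real n * (val t1 t2 x - ball_exponent + \<eta>)"
        by (rule mult_left_mono) simp
      then show ?thesis using bn_pos[OF n] by (intro mult_left_mono) auto
    qed
    ultimately show ?case using * by (simp add: x_def)
  qed
qed

section \<open>Bounds for the laws\<close>

lemma law_eq:
  assumes n: "n > 0" and A: "A \<in> sets borel" and pos: "vol n UNIV > 0"
  shows "law_scaled_norm p q n A = vol n A / vol n UNIV"
proof -
  let ?L = "lebesgue_n n" and ?B = "lp_ball p n"
  have U: "vol n UNIV = measure ?L ?B" by (simp add: vol_def)
  have "emeasure ?L ?B \<noteq> 0" "emeasure ?L ?B \<noteq> \<infinity>"
    using pos emeasure_slice_finite[OF n, of UNIV] by (auto simp: U measure_def)
  moreover have "{x \<in> space ?L. scaled_norm n x \<in> A} \<in> sets ?L"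
    using A by measurable
  moreover have "?B \<inter> {x \<in> space ?L. scaled_norm n x \<in> A} = {x \<in> ?B. scaled_norm n x \<in> A}"
    by (auto simp: lp_ball_def)
  ultimately have "measure (uniform_measure ?L ?B) {x \<in> space ?L. scaled_norm n x \<in> A}
    = vol n A / vol n UNIV"
    by (simp add: measure_uniform_measure U) (simp add: vol_def)
  then show ?thesis
    by (simp add: law_scaled_norm_def unif_lp_ball_def scaled_norm_def)
qed

text \<open>Comes from the tilting bound at the typical value \<open>zs\<close>, where
  \<open>val\<close> is 0, instead of a volume formula for the ball.\<close>

lemma vol_UNIV_lower:
  assumes "\<eta> > 0"
  shows "\<forall>\<^sub>F n in sequentially. bn n ^ n * exp (n * (ball_exponent - \<eta>)) \<le> vol n UNIV"
  using vol_lower[of 0 "- (1 / p)" zs UNIV \<eta>] optimal_std zs assms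
  by (simp add: val_std algebra_simps)

lemma vol_UNIV_le: "n > 0 \<Longrightarrow> vol n UNIV \<le> bn n ^ n * exp (n * ball_exponent)"
  using vol_le[OF _ admissible_std, of n UNIV zs] by (simp add: val_std)

text \<open>As \<open>t1 \<le> 0\<close>, the worst point of the piece is its rightmost one, and the
  pair found there bounds the whole piece. Negative points of \<open>F\<close> are never hit by a
  norm.\<close>

lemma vol_left_piece:
  assumes n: "n > 0" and F: "closed F" "\<And>z. z \<in> F \<Longrightarrow> ereal \<alpha> < Irate p q z"
  shows "vol n (F \<inter> {..zs}) \<le> bn n ^ n * exp (- (n * (\<alpha> - ball_exponent)))"
proof (cases "F \<inter> {0..zs} = {}")
  case True
  have "{x \<in> lp_ball p n. scaled_norm n x \<in> F \<inter> {..zs}} = {}"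
    using True scaled_norm_nonneg by fastforce
  then have "vol n (F \<inter> {..zs}) = 0" by (simp only: vol_def measure_empty)
  then show ?thesis using bn_pos[OF n] by simp
next
  case False
  have c: "compact (F \<inter> {0..zs})" using F(1) by (intro closed_Int_compact) auto
  obtain z where z: "z \<in> F \<inter> {0..zs}" "\<And>v. v \<in> F \<inter> {0..zs} \<Longrightarrow> v \<le> z"
    using compact_attains_sup[OF c False] by blast
  obtain t1 t2 where t: "t1 \<le> 0" "admissible t1 t2" "\<alpha> \<le> val t1 t2 (z powr q)"
    using multiplier_left[of \<alpha> z] F(2) z by auto
  have "vol n (F \<inter> {..zs}) \<le> bn n ^ n * exp (- (n * (val t1 t2 (z powr q) - ball_exponent)))"
  proof (rule vol_le[OF n t(2)])
    show "F \<inter> {..zs} \<in> sets borel" using F(1) by auto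
    fix v assume "v \<in> F \<inter> {..zs}" "0 \<le> v"
    then show "t1 * z powr q \<le> t1 * v powr q"
      using z(2)[of v] t(1) pq_pos by (intro mult_left_mono_neg powr_mono2) auto
  qed
  also have "\<dots> \<le> bn n ^ n * exp (- (n * (\<alpha> - ball_exponent)))"
    using t(3) bn_pos[OF n] by (intro mult_left_mono) (auto intro!: mult_left_mono)
  finally show ?thesis .
qed

lemma vol_right_piece:
  assumes n: "n > 0" and F: "closed F" "\<And>z. z \<in> F \<Longrightarrow> ereal \<alpha> < Irate p q z"
  shows "vol n (F \<inter> {zs..}) \<le> bn n ^ n * exp (- (n * (\<alpha> - ball_exponent)))"
proof (cases "F \<inter> {zs..} = {}")
  case True
  then show ?thesis using bn_pos[OF n] by (simp add: vol_def)
next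
  case False
  then obtain w where w: "w \<in> F" "zs \<le> w" by auto
  \<comment> \<open>The cut at some \<open>w\<close> in \<open>F\<close> provides compactness; the
    minimum is still the leftmost point of \<open>F\<close> from \<open>zs\<close> on.\<close>
  have c: "compact (F \<inter> {zs..w})" using F(1) by (intro closed_Int_compact) auto
  obtain z where z: "z \<in> F \<inter> {zs..w}" "\<And>v. v \<in> F \<inter> {zs..w} \<Longrightarrow> z \<le> v"
  proof -
    have "F \<inter> {zs..w} \<noteq> {}" using w by auto
    then show ?thesis using compact_attains_inf[OF c] that by blast
  qed
  have zv: "z \<le> v" if "v \<in> F" "zs \<le> v" for v
    using z that by (cases "v \<le> w") auto
  obtain t1 t2 where t: "t1 \<ge> 0" "admissible t1 t2" "\<alpha> \<le> val t1 t2 (z powr q)"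
    using multiplier_right[of \<alpha> z] F(2) z by auto
  have "vol n (F \<inter> {zs..}) \<le> bn n ^ n * exp (- (n * (val t1 t2 (z powr q) - ball_exponent)))"
  proof (rule vol_le[OF n t(2)])
    show "F \<inter> {zs..} \<in> sets borel" using F(1) by auto
    fix v assume "v \<in> F \<inter> {zs..}" "0 \<le> v"
    then show "t1 * z powr q \<le> t1 * v powr q"
      using zv[of v] z(1) zs(1) t(1) pq_pos by (intro mult_left_mono powr_mono2) auto
  qed
  also have "\<dots> \<le> bn n ^ n * exp (- (n * (\<alpha> - ball_exponent)))"
    using t(3) bn_pos[OF n] by (intro mult_left_mono) (auto intro!: mult_left_mono)
  finally show ?thesis .
qed

lemma law_upper:
  fixes \<alpha> :: real
  assumes A: "A \<in> sets borel" and \<alpha>: "ereal \<alpha> < (INF z\<in>closure A. Irate p q z)"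
  shows "\<forall>\<^sub>F n in sequentially. law_scaled_norm p q n A \<le> exp (- (n * \<alpha>))"
proof -
  obtain \<beta> where \<beta>: "\<alpha> < \<beta>" "ereal \<beta> < (INF z\<in>closure A. Irate p q z)"
    using ereal_dense2[OF \<alpha>] by auto
  have I: "ereal \<beta> < Irate p q z" if "z \<in> closure A" for z
    using less_INF_D[OF \<beta>(2) that] .
  \<comment> \<open>One half of the gap \<open>\<beta> - \<alpha>\<close> pays for the lower bound
    on the ball, the other for the factor 2 from the two pieces.\<close>
  define \<eta> where "\<eta> = (\<beta> - \<alpha>) / 2"
  have \<eta>: "\<eta> > 0" using \<beta> by (simp add: \<eta>_def)
  have "(\<lambda>n. 2 * exp (- (real n * \<eta>))) \<longlonglongrightarrow> 0" using \<eta> by real_asymp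
  then have "\<forall>\<^sub>F n in sequentially. 2 * exp (- (real n * \<eta>)) < 1" by (rule order_tendstoD) simp
  then show ?thesis using vol_UNIV_lower[OF \<eta>] eventually_gt_at_top[of 0]
  proof eventually_elim
    case (elim n)
    then have n: "n > 0" by simp
    have b: "bn n ^ n > 0" using bn_pos[OF n] by simp
    have low: "0 < bn n ^ n * exp (n * (ball_exponent - \<eta>))" using b by simp
    then have U: "vol n UNIV > 0" using elim by linarith
    have "vol n A \<le> vol n ((closure A \<inter> {..zs}) \<union> (closure A \<inter> {zs..}))"
      using closure_subset[of A] A by (intro vol_mono n) auto
    also have "\<dots> \<le> vol n (closure A \<inter> {..zs}) + vol n (closure A \<inter> {zs..})"
      by (intro vol_Un_le n) auto
    also have "\<dots> \<le> bn n ^ n * exp (- (n * (\<beta> - ball_exponent))) + bn n ^ n * exp (- (n * (\<beta> - ball_exponent)))"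
      using I by (intro add_mono vol_left_piece vol_right_piece n) auto
    finally have up: "vol n A \<le> 2 * (bn n ^ n * exp (- (n * (\<beta> - ball_exponent))))" by simp
    have "law_scaled_norm p q n A = vol n A / vol n UNIV" by (rule law_eq[OF n A U])
    also have "\<dots> \<le> 2 * (bn n ^ n * exp (- (n * (\<beta> - ball_exponent)))) / (bn n ^ n * exp (n * (ball_exponent - \<eta>)))"
      using up elim low b vol_nonneg by (intro frac_le) (auto simp: less_imp_le)
    also have "\<dots> = 2 * exp (- (n * (\<beta> - ball_exponent)) - n * (ball_exponent - \<eta>))"
      using bn_pos[OF n] unfolding exp_diff by simp
    also have "- (n * (\<beta> - ball_exponent)) - n * (ball_exponent - \<eta>) = - (n * \<eta>) + - (n * \<alpha>)"
      by (simp add: \<eta>_def field_simps)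
    also have "2 * exp (- (n * \<eta>) + - (n * \<alpha>)) = (2 * exp (- (n * \<eta>))) * exp (- (n * \<alpha>))"
      unfolding exp_add by simp
    also have "\<dots> \<le> 1 * exp (- (n * \<alpha>))" using elim by (intro mult_right_mono) auto
    finally show ?case by simp
  qed
qed

lemma law_lower:
  fixes \<alpha> :: real
  assumes A: "A \<in> sets borel" and z: "z \<in> interior A" and \<alpha>: "Irate p q z < ereal \<alpha>"
  shows "\<forall>\<^sub>F n in sequentially. exp (- (n * \<alpha>)) \<le> law_scaled_norm p q n A"
proof -
  have "Irate p q z < \<infinity>" using \<alpha> by auto
  then obtain t1 t2 where t: "0 < z" "z < 1" "optimal t1 t2 (z powr q)" by (rule Irate_finite_optimal)
  define v where "v = val t1 t2 (z powr q)"
  have v: "v < \<alpha>" using \<alpha> Irate_optimal[OF t(3)] t(1) by (simp add: v_def)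
  define \<eta> where "\<eta> = \<alpha> - v"
  have \<eta>: "\<eta> > 0" using v by (simp add: \<eta>_def)
  show ?thesis
    using vol_lower[OF t(3,1) open_interior z \<eta>] eventually_gt_at_top[of 0] vol_UNIV_lower[OF \<eta>]
  proof eventually_elim
    case (elim n)
    then have n: "n > 0" by simp
    have b: "bn n ^ n > 0" using bn_pos[OF n] by simp
    have "0 < bn n ^ n * exp (n * (ball_exponent - \<eta>))" using b by simp
    then have U: "vol n UNIV > 0" using elim by linarith
    have "exp (- (n * \<alpha>)) = exp (- (n * (v - ball_exponent + \<eta>)) - n * ball_exponent)"
      by (simp add: \<eta>_def algebra_simps)
    also have "\<dots> = (bn n ^ n * exp (- (n * (v - ball_exponent + \<eta>)))) / (bn n ^ n * exp (n * ball_exponent))"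
      using bn_pos[OF n] unfolding exp_diff by simp
    also have "\<dots> \<le> vol n (interior A) / vol n UNIV"
      using elim U vol_UNIV_le[OF n] b vol_nonneg by (intro frac_le) (auto simp: v_def)
    also have "\<dots> \<le> vol n A / vol n UNIV"
      using U A interior_subset[of A] by (intro divide_right_mono vol_mono n) auto
    also have "\<dots> = law_scaled_norm p q n A" by (rule law_eq[OF n A U, symmetric])
    finally show ?case .
  qed
qed

lemma LDP_Irate: "LDP (\<lambda>n. real n) (law_scaled_norm p q) (Irate p q)"
  unfolding LDP_def
proof (intro conjI ballI)
  show "rate_function (Irate p q)" using good_Irate by (simp add: good_rate_function_def)
  fix A :: "real set" assume A: "A \<in> sets borel"
  define a where "a n = elog (law_scaled_norm p q n A) / ereal (real n)" for n
  have "- Irate p q z \<le> liminf a" if z: "z \<in> interior A" for z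
    unfolding le_Liminf_iff
  proof safe
    fix y assume "y < - Irate p q z"
    then obtain r where r: "y < ereal r" "ereal r < - Irate p q z" using ereal_dense2 by blast
    then have "Irate p q z < ereal (- r)" by (simp add: ereal_less_uminus_reorder[of "ereal r"])
    from law_lower[OF A z this] eventually_gt_at_top[of 0]
    show "\<forall>\<^sub>F n in sequentially. y < a n"
    proof eventually_elim
      case (elim n)
      then have "ereal (- (- r)) \<le> a n" unfolding a_def by (intro elog_divide_ge)
      then show ?case using r(1) by (simp add: less_le_trans)
    qed
  qed
  \<comment> \<open>An empty interior is included: the infimum is then
    \<open>\<infinity>\<close>.\<close>
  then have "- liminf a \<le> (INF z\<in>interior A. Irate p q z)"
    by (intro INF_greatest) (simp add: ereal_uminus_le_reorder)
  then show "- (INF z\<in>interior A. Irate p q z) \<le> liminf (\<lambda>n. elog (law_scaled_norm p q n A) / ereal (real n))"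
    by (simp add: ereal_uminus_le_reorder a_def[symmetric])
  show "limsup (\<lambda>n. elog (law_scaled_norm p q n A) / ereal (real n)) \<le> - (INF z\<in>closure A. Irate p q z)"
    unfolding a_def[symmetric]
  proof (rule ccontr)
    assume "\<not> limsup a \<le> - (INF z\<in>closure A. Irate p q z)"
    then have "- limsup a < (INF z\<in>closure A. Irate p q z)"
      by (simp add: ereal_uminus_less_reorder not_le)
    then obtain \<alpha> where \<alpha>: "- limsup a < ereal \<alpha>" "ereal \<alpha> < (INF z\<in>closure A. Irate p q z)"
      using ereal_dense2 by blast
    have "\<forall>\<^sub>F n in sequentially. a n \<le> ereal (- \<alpha>)"
      using law_upper[OF A \<alpha>(2)] eventually_gt_at_top[of 0]
      by eventually_elim (simp add: a_def elog_divide_le)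
    then have "limsup a \<le> ereal (- \<alpha>)" by (rule Limsup_bounded)
    with \<alpha>(1) show False by (cases "limsup a") auto
  qed
qed

end

theorem theorem1p2:
  fixes p q :: real
  assumes "1 \<le> q" and "q < p"
  shows "LDP (\<lambda>n. real n) (law_scaled_norm p q) (Irate p q) \<and> good_rate_function (Irate p q)"
proof -
  interpret lp_exponents p q by unfold_locales (use assms in auto)
  show ?thesis using LDP_Irate good_Irate by simp
qed

end
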